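(* Let $(z,z')\in\mathbb C^2$. Then, as operators on $\mathrm{Sym}_{\mathbb C}$, $$\lim_{\varepsilon\to0}\mathfrak D^{\mathsf M,\varepsilon}=\mathfrak D^{\mathsf L},$$ where $\varepsilon\in\mathbb C\setminus\{0\}$, $\mathfrak D^{\mathsf L}$ is the Laguerre operator with parameters $(z,z')$ and $\mathfrak D^{\mathsf M,\varepsilon}=\varepsilon^{-G}\circ\mathfrak D^{\mathsf M}\circ\varepsilon^{G}$ with $\mathfrak D^{\mathsf M}$ the Meixner operator with parameters $(z,z')$ and $\xi=1-\varepsilon$. (The limit is understood on each finite-dimensional space of elements of degree $\le n$ in $\mathrm{Sym}_{\mathbb C}$, which all these operators preserve.)
   Context: $\mathbb Y$ is the set of all partitions (Young diagrams); $|\nu|$ is the number of boxes and $\ell(\nu)$ the number of nonzero rows of $\nu$. For a box $\square=(i,j)$ (row $i$, column $j$), $c(\square)=j-i$. $\nu^-$ is the set of boxes $\square\in\nu$ such that $\nu\setminus\square$ is again a Young diagram. $\mathrm{Sym}$ is the graded algebra of symmetric functions over $\mathbb R$, freely generated by the power sums $p_k$; $\mathrm{Sym}_{\mathbb C}$ is its complexification; $S_\nu$ are the Schur functions. For $\varepsilon\in\mathbb C\setminus\{0\}$, $\varepsilon^{\pm G}$ acts on the $m$th homogeneous component as multiplication by $\varepsilon^{\pm m}$. Frobenius–Schur functions. Put $x^{\downarrow n}=x(x-1)\cdots(x-n+1)$. The factorial Schur polynomial is $S^{\mathsf f}_{\nu\mid N}(x_1,\dots,x_N)=\det[x_j^{\downarrow(\nu_i+N-i)}]_{i,j=1}^N/\prod_{i<j}(x_i-x_j)$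 for $\ell(\nu)\le N$ (and $0$ if $\ell(\nu)>N$). The shifted Schur polynomial is $S^*_{\nu\mid N}(y_1,\dots,y_N)=S^{\mathsf f}_{\nu\mid N}(y_1+N-1,y_2+N-2,\dots,y_N)$; it satisfies $S^*_{\nu\mid N}|_{y_N=0}=S^*_{\nu\mid N-1}$. A polynomial in $y_1,\dots,y_N$ is shifted symmetric if it is symmetric in the variables $y_i+N-i$; $\mathrm{Sym}^*$ is the algebra of sequences $(f_N)_{N\ge1}$ of shifted symmetric polynomials in $N$ variables with $f_N|_{y_N=0}=f_{N-1}$ and $\sup_N\deg f_N<\infty$. Thus $S^*_\nu=(S^*_{\nu\mid N})_N\in\mathrm{Sym}^*$. The algebra $\mathrm{Sym}^*$ is freely generated by $p_k^*=\sum_{i\ge1}[(y_i-i+\frac12)^k-(-i+\frac12)^k]$, $k\ge1$, and $FS_\nu\in\mathrm{Sym}$ is the image of $S^*_\nu$ under the algebra isomorphism $\mathrm{Sym}^*\to\mathrm{Sym}$, $p^*_k\mapsto p_k$. The $FS_\nu$ form a basis of $\mathrm{Sym}$. The Laguerre operator with parameters $(z,z')$ and the Meixner operator with parameters $(z,z',\xi)$, $\xi\neq1$, are the linear operators on $\mathrm{Sym}_{\mathbb C}$ given, for $\nu\in\mathbb Y$, by $$\mathfrak D^{\mathsf L}S_\nu=-|\nu|S_\nu+\sum_{\square\in\nu^-}(z+c(\square))(z'+c(\square))S_{\nu\setminus\square},$$ $$\mathfrak D^{\mathsf M}FS_\nu=-|\nu|FS_\nu+\frac{\xi}{1-\xi}\sum_{\square\in\nu^-}(z+c(\square))(z'+c(\square))FS_{\nu\setminus\square}.$$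 *)

theory Defs
  imports
    Complex_Main
    "HOL-Library.Poly_Mapping"
    "HOL-Library.FuncSet"
    "HOL-Combinatorics.Permutations"
    "Jordan_Normal_Form.Determinant"
begin

section \<open>Polynomials\<close>

text \<open>
  Polynomials over \<open>'a\<close> in the indeterminates \<open>Var 0, Var 1, \<dots>\<close>: finitely supported
  functions from monomials (finitely supported exponent vectors) to coefficients, with the
  convolution product of \<open>Poly_Mapping\<close>.  All indices start from \<open>0\<close>, so the variables
  \<open>x\<^sub>1, \<dots>, x\<^sub>N\<close> (or \<open>y\<^sub>1, \<dots>, y\<^sub>N\<close>) of the mathematical text are \<open>Var 0, \<dots>, Var (N - 1)\<close>.
\<close>

type_synonym mono = "nat \<Rightarrow>\<^sub>0 nat"
type_synonym 'a mpoly = "mono \<Rightarrow>\<^sub>0 'a"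

definition Const :: "'a::zero \<Rightarrow> 'a mpoly" where
  "Const c = Poly_Mapping.single 0 c"

definition Var :: "nat \<Rightarrow> 'a::zero_neq_one mpoly" where
  "Var i = Poly_Mapping.single (Poly_Mapping.single i 1) 1"

definition subst :: "(nat \<Rightarrow> 'a mpoly) \<Rightarrow> 'a::comm_ring_1 mpoly \<Rightarrow> 'a mpoly" where
  "subst \<sigma> f = (\<Sum>m\<in>Poly_Mapping.keys f. Const (Poly_Mapping.lookup f m) *
     (\<Prod>i\<in>Poly_Mapping.keys m. \<sigma> i ^ Poly_Mapping.lookup m i))"

definition in_vars :: "nat \<Rightarrow> 'a::zero mpoly \<Rightarrow> bool" where
  "in_vars N f \<longleftrightarrow> (\<forall>m\<in>Poly_Mapping.keys f. Poly_Mapping.keys m \<subseteq> {..<N})"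

definition mdegree :: "mono \<Rightarrow> nat" where
  "mdegree m = (\<Sum>i\<in>Poly_Mapping.keys m. Poly_Mapping.lookup m i)"

definition symmetric_poly :: "nat \<Rightarrow> 'a::comm_ring_1 mpoly \<Rightarrow> bool" where
  "symmetric_poly N f \<longleftrightarrow>
     in_vars N f \<and> (\<forall>\<pi>. \<pi> permutes {..<N} \<longrightarrow> subst (\<lambda>i. Var (\<pi> i)) f = f)"

definition exact_quotient :: "'a::comm_ring_1 mpoly \<Rightarrow> 'a mpoly \<Rightarrow> 'a mpoly" where
  "exact_quotient f g = (THE q. q * g = f)"

definition falling :: "'a::comm_ring_1 \<Rightarrow> nat \<Rightarrow> 'a" where
  "falling x n = (\<Prod>k<n. x - of_nat k)"

definition vandermonde :: "nat \<Rightarrow> 'a::comm_ring_1 mpoly" where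
  "vandermonde N = (\<Prod>(i, j)\<in>{(i, j). i < j \<and> j < N}. Var i - Var j)"


section \<open>Young diagrams\<close>

text \<open>
  Boxes \<open>(i, j)\<close> (row, column) are also indexed from \<open>0\<close>; the content \<open>j - i\<close> is not
  affected by this.
\<close>

definition young :: "(nat \<times> nat) set set" where
  "young = {\<nu>. finite \<nu> \<and> (\<forall>i j i' j'. (i, j) \<in> \<nu> \<and> i' \<le> i \<and> j' \<le> j \<longrightarrow> (i', j') \<in> \<nu>)}"

definition row :: "(nat \<times> nat) set \<Rightarrow> nat \<Rightarrow> nat" where
  "row \<nu> i = card {j. (i, j) \<in> \<nu>}"

definition num_rows :: "(nat \<times> nat) set \<Rightarrow> nat" where
  "num_rows \<nu> = card {i. row \<nu> i \<noteq> 0}"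

definition content :: "nat \<times> nat \<Rightarrow> int" where
  "content b = int (snd b) - int (fst b)"

definition corners :: "(nat \<times> nat) set \<Rightarrow> (nat \<times> nat) set" where
  "corners \<nu> = {b \<in> \<nu>. \<nu> - {b} \<in> young}"


section \<open>Symmetric functions\<close>

text \<open>
  The algebra of symmetric functions is the polynomial algebra in the power sums, with
  \<open>Var k\<close> standing for \<open>p\<^bsub>k+1\<^esub>\<close>.  Hence the grading gives \<open>Var k\<close> the weight \<open>k + 1\<close>.
\<close>

type_synonym 'a sym = "'a mpoly"

definition weight :: "mono \<Rightarrow> nat" where
  "weight m = (\<Sum>k\<in>Poly_Mapping.keys m. Suc k * Poly_Mapping.lookup m k)"

definition sym_upto :: "nat \<Rightarrow> 'a::zero sym set" where
  "sym_upto n = {f. \<forall>m\<in>Poly_Mapping.keys f. weight m \<le> n}"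

text \<open>The specialization of a symmetric function to \<open>N\<close> variables.\<close>

definition specialize :: "nat \<Rightarrow> real sym \<Rightarrow> real mpoly" where
  "specialize N = subst (\<lambda>k. \<Sum>i<N. Var i ^ Suc k)"

text \<open>
  The row length \<open>\<nu>\<^bsub>i+1\<^esub>\<close> is \<open>row \<nu> i\<close>, so the exponent \<open>\<nu>\<^sub>i + N - i\<close> of the determinantal
  formulas becomes \<open>row \<nu> i + (N - Suc i)\<close>.
\<close>

definition schur_poly :: "(nat \<times> nat) set \<Rightarrow> nat \<Rightarrow> real mpoly" where
  "schur_poly \<nu> N =
     (if num_rows \<nu> \<le> N
      then exact_quotient (det (mat N N (\<lambda>(i, j). Var j ^ (row \<nu> i + (N - Suc i))))) (vandermonde N)
      else 0)"

definition schur :: "(nat \<times> nat) set \<Rightarrow> real sym" where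
  "schur \<nu> = (THE f. \<forall>N. specialize N f = schur_poly \<nu> N)"


section \<open>Shifted symmetric functions and Frobenius--Schur functions\<close>

definition factorial_schur_poly :: "(nat \<times> nat) set \<Rightarrow> nat \<Rightarrow> real mpoly" where
  "factorial_schur_poly \<nu> N =
     (if num_rows \<nu> \<le> N
      then exact_quotient (det (mat N N (\<lambda>(i, j). falling (Var j) (row \<nu> i + (N - Suc i))))) (vandermonde N)
      else 0)"

text \<open>The substitution \<open>x\<^sub>i = y\<^sub>i + N - i\<close>.\<close>

definition shift :: "nat \<Rightarrow> real mpoly \<Rightarrow> real mpoly" where
  "shift N = subst (\<lambda>i. Var i + of_nat (N - Suc i))"

definition shifted_schur :: "(nat \<times> nat) set \<Rightarrow> nat \<Rightarrow> real mpoly" where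
  "shifted_schur \<nu> N = shift N (factorial_schur_poly \<nu> N)"

definition shifted_symmetric_poly :: "nat \<Rightarrow> real mpoly \<Rightarrow> bool" where
  "shifted_symmetric_poly N f \<longleftrightarrow> (\<exists>g. symmetric_poly N g \<and> f = shift N g)"

text \<open>
  Elements are sequences \<open>(f\<^sub>N)\<close>.  The index \<open>N = 0\<close> is included for convenience: \<open>f\<^sub>0\<close> is the
  constant obtained from \<open>f\<^sub>1\<close> by setting \<open>y\<^sub>1 = 0\<close>, so it carries no additional information.
\<close>

definition sym_star :: "(nat \<Rightarrow> real mpoly) set" where
  "sym_star = {f. (\<forall>N. shifted_symmetric_poly N (f N)) \<and>
     (\<forall>N. subst (\<lambda>i. if i = N then 0 else Var i) (f (Suc N)) = f N) \<and>
     (\<exists>d. \<forall>N. \<forall>m\<in>Poly_Mapping.keys (f N). mdegree m \<le> d)}"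

definition power_sum_star :: "nat \<Rightarrow> nat \<Rightarrow> real mpoly" where
  "power_sum_star k N =
     (\<Sum>i<N. (Var i + Const (- real (Suc i) + 1/2)) ^ k - Const ((- real (Suc i) + 1/2) ^ k))"

text \<open>
  The isomorphism from \<open>sym_star\<close> onto the algebra of symmetric functions sending
  \<open>p\<^sub>k\<^sup>*\<close> to \<open>p\<^sub>k\<close>, given as the inverse of the algebra homomorphism that sends \<open>p\<^sub>k\<close> to \<open>p\<^sub>k\<^sup>*\<close>.
\<close>

definition sym_to_star :: "real sym \<Rightarrow> nat \<Rightarrow> real mpoly" where
  "sym_to_star f = (\<lambda>N. subst (\<lambda>k. power_sum_star (Suc k) N) f)"

definition star_to_sym :: "(nat \<Rightarrow> real mpoly) \<Rightarrow> real sym" where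
  "star_to_sym = restrict (inv_into UNIV sym_to_star) sym_star"

definition frobenius_schur :: "(nat \<times> nat) set \<Rightarrow> real sym" where
  "frobenius_schur \<nu> = star_to_sym (shifted_schur \<nu>)"


section \<open>Operators on the complexified algebra\<close>

definition complexify :: "real sym \<Rightarrow> complex sym" where
  "complexify = Poly_Mapping.map complex_of_real"

definition scale :: "complex \<Rightarrow> complex sym \<Rightarrow> complex sym" where
  "scale c = Poly_Mapping.map ((*) c)"

definition laguerre_op :: "complex \<Rightarrow> complex \<Rightarrow> complex sym \<Rightarrow> complex sym" where
  "laguerre_op z z' = (THE D. Vector_Spaces.linear scale scale D \<and>
     (\<forall>\<nu>\<in>young. D (complexify (schur \<nu>)) =
        scale (- of_nat (card \<nu>)) (complexify (schur \<nu>)) +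
        (\<Sum>b\<in>corners \<nu>. scale ((z + of_int (content b)) * (z' + of_int (content b)))
           (complexify (schur (\<nu> - {b}))))))"

definition meixner_op :: "complex \<Rightarrow> complex \<Rightarrow> complex \<Rightarrow> complex sym \<Rightarrow> complex sym" where
  "meixner_op z z' \<xi> = (THE D. Vector_Spaces.linear scale scale D \<and>
     (\<forall>\<nu>\<in>young. D (complexify (frobenius_schur \<nu>)) =
        scale (- of_nat (card \<nu>)) (complexify (frobenius_schur \<nu>)) +
        scale (\<xi> / (1 - \<xi>))
          (\<Sum>b\<in>corners \<nu>. scale ((z + of_int (content b)) * (z' + of_int (content b)))
             (complexify (frobenius_schur (\<nu> - {b}))))))"

text \<open>\<open>pow_G \<epsilon> s\<close> is \<open>\<epsilon>\<^bsup>sG\<^esup>\<close>, for an integer \<open>s\<close>.\<close>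

definition pow_G :: "complex \<Rightarrow> int \<Rightarrow> complex sym \<Rightarrow> complex sym" where
  "pow_G \<epsilon> s = Poly_Mapping.mapp (\<lambda>m a. \<epsilon> powi (s * int (weight m)) * a)"

definition meixner_eps :: "complex \<Rightarrow> complex \<Rightarrow> complex \<Rightarrow> complex sym \<Rightarrow> complex sym" where
  "meixner_eps z z' \<epsilon> = pow_G \<epsilon> (-1) \<circ> meixner_op z z' (1 - \<epsilon>) \<circ> pow_G \<epsilon> 1"

text \<open>
  Convergence of operators on a subspace \<open>V\<close>, in the operator norm belonging to the
  \<open>\<ell>\<^sup>1\<close>-norm of coefficients.  For finite-dimensional \<open>V\<close> the choice of the norm is immaterial.
\<close>

definition coeff_norm :: "complex sym \<Rightarrow> real" where
  "coeff_norm f = (\<Sum>m\<in>Poly_Mapping.keys f. norm (Poly_Mapping.lookup f m))"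

definition op_tendsto_on ::
  "complex sym set \<Rightarrow> ('b \<Rightarrow> complex sym \<Rightarrow> complex sym) \<Rightarrow> (complex sym \<Rightarrow> complex sym) \<Rightarrow>
    'b filter \<Rightarrow> bool" where
  "op_tendsto_on V A B F \<longleftrightarrow>
     (\<forall>e>0. \<forall>\<^sub>F t in F. \<forall>f\<in>V. coeff_norm (A t f - B f) \<le> e * coeff_norm f)"

end

theory Submission
  imports Defs "HOL-Computational_Algebra.Formal_Power_Series"
begin

text \<open>
  The limit is read off from a basis. Let \<open>F\<^sub>\<nu>\<close> be \<open>\<epsilon>\<^bsup>|\<nu>|\<^esup> \<epsilon>\<^bsup>-G\<^esup> FS\<^sub>\<nu>\<close>. Since
  \<open>FS\<^sub>\<nu> = S\<^sub>\<nu> + (terms of lower degree)\<close> and \<open>S\<^sub>\<nu>\<close> is homogeneous of degree \<open>|\<nu>|\<close>, \<open>F\<^sub>\<nu> \<rightarrow> S\<^sub>\<nu>\<close>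
  as \<open>\<epsilon> \<rightarrow> 0\<close>. For \<open>\<xi> = 1 - \<epsilon>\<close> the rescaled Meixner operator satisfies
  \<open>F\<^sub>\<nu> \<mapsto> - |\<nu>| F\<^sub>\<nu> + (1 - \<epsilon>) \<Sum> (z + c(b)) (z' + c(b)) F\<^bsub>\<nu> - b\<^esub>\<close>, where the pole of
  \<open>\<xi> / (1 - \<xi>) = (1 - \<epsilon>) / \<epsilon>\<close> is cancelled because \<open>\<nu> - b\<close> has one box less than \<open>\<nu>\<close>. The
  right-hand side tends to the value of the Laguerre operator at \<open>S\<^sub>\<nu>\<close>, and induction on the
  degree replaces \<open>F\<^sub>\<nu>\<close> by \<open>S\<^sub>\<nu>\<close> on the left (\<open>meixner_eps_tendsto\<close>).

  What has to be established is that the symmetric functions \<open>S\<^sub>\<nu>\<close> and \<open>FS\<^sub>\<nu>\<close> exist, are bases,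
  and have the same leading terms. Both are instances of one family: for parameters \<open>c\<^sub>j\<close> (\<open>j\<close>
  an integer) the function \<open>multi_schur c \<nu>\<close> is defined by a determinant of Jacobi--Trudi type
  in the polynomial algebra of power sums, and under \<open>p\<^sub>k \<mapsto> \<Sum>\<^bsub>i<N\<^esub> (w\<^sub>i\<^sup>k - c\<^sub>i\<^sup>k)\<close> it becomes
  the quotient of the alternant \<open>det [\<Prod>\<^bsub>k < \<nu>\<^sub>i + N - 1 - i\<^esub> (w\<^sub>j - c\<^bsub>N-1-k\<^esub>)]\<close> by
  \<open>\<Prod>\<^bsub>i<j\<^esub> (w\<^sub>i - w\<^sub>j)\<close> (\<open>super_eval_multi_schur\<close>). The case \<open>c = 0\<close> gives \<open>S\<^sub>\<nu>\<close> (\<open>schur_eq\<close>),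
  the case \<open>c\<^sub>j = - j - 1/2\<close> gives \<open>FS\<^sub>\<nu>\<close> (\<open>frobenius_schur_eq\<close>), and the leading terms of the
  determinants do not depend on \<open>c\<close> (\<open>leading_part_multi_schur\<close>).

  The alternants of distinct diagrams are linearly independent because their leading monomials
  differ. As there are at least as many diagrams with at most \<open>n\<close> boxes as power-sum monomials
  of weight at most \<open>n\<close>, the functions \<open>multi_schur c \<nu>\<close> form a basis
  (\<open>sym_upto_span_multi_schur\<close>), and an element of \<open>Sym\<close> is determined by its specializations
  (\<open>super_eval_eq_0_imp\<close>). For \<open>c = 0\<close> the latter is the algebraic independence of the power
  sums, which makes \<open>schur\<close> well defined, and for \<open>c\<^sub>j = - j - 1/2\<close> it yields the injectivity of
  \<open>sym_to_star\<close>.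
\<close>

section \<open>Substitution into polynomials\<close>

lemma subst_extend:
  assumes "finite K" "Poly_Mapping.keys f \<subseteq> K"
  shows "subst s f = (\<Sum>m\<in>K. Const (Poly_Mapping.lookup f m) *
     (\<Prod>i\<in>Poly_Mapping.keys m. s i ^ Poly_Mapping.lookup m i))"
  unfolding subst_def using assms
  by (intro sum.mono_neutral_left) (auto simp: Const_def in_keys_iff)

text \<open>The value of a monomial under the substitution \<open>s\<close>.\<close>

definition mono_value :: "(nat \<Rightarrow> 'a::comm_ring_1 mpoly) \<Rightarrow> mono \<Rightarrow> 'a mpoly" where
  "mono_value s m = (\<Prod>i\<in>Poly_Mapping.keys m. s i ^ Poly_Mapping.lookup m i)"

lemma mono_value_extend:
  assumes "finite K" "Poly_Mapping.keys m \<subseteq> K"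
  shows "mono_value s m = (\<Prod>i\<in>K. s i ^ Poly_Mapping.lookup m i)"
  unfolding mono_value_def using assms
  by (intro prod.mono_neutral_left) (auto simp: in_keys_iff)

lemma mono_value_add: "mono_value s (m + m') = mono_value s m * mono_value s m'"
proof -
  let ?K = "Poly_Mapping.keys m \<union> Poly_Mapping.keys m'"
  have sub: "Poly_Mapping.keys (m + m') \<subseteq> ?K" by (rule keys_add)
  have "mono_value s (m + m') = (\<Prod>i\<in>?K. s i ^ Poly_Mapping.lookup (m + m') i)"
    by (rule mono_value_extend) (use sub in auto)
  also have "\<dots> = (\<Prod>i\<in>?K. s i ^ Poly_Mapping.lookup m i) * (\<Prod>i\<in>?K. s i ^ Poly_Mapping.lookup m' i)"
    by (simp add: lookup_add power_add prod.distrib)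
  also have "\<dots> = mono_value s m * mono_value s m'"
    by (simp add: mono_value_extend[of ?K])
  finally show ?thesis .
qed

lemma Const_add: "Const (a + b) = Const a + Const b"
  by (simp add: Const_def single_add)

lemma Const_mult: "Const (a * b) = Const a * Const b"
  by (simp add: Const_def mult_single)

lemma subst_single: "subst s (Poly_Mapping.single m c) = Const c * mono_value s m"
  by (cases "c = 0") (auto simp: subst_def mono_value_def Const_def)

lemma subst_add: "subst s (f + g) = subst s f + subst s g"
proof -
  let ?K = "Poly_Mapping.keys f \<union> Poly_Mapping.keys g"
  have "Poly_Mapping.keys (f + g) \<subseteq> ?K" by (rule keys_add)
  then have "subst s (f + g) = (\<Sum>m\<in>?K. Const (Poly_Mapping.lookup (f + g) m) *
     (\<Prod>i\<in>Poly_Mapping.keys m. s i ^ Poly_Mapping.lookup m i))"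
    by (intro subst_extend) auto
  moreover have "subst s f = (\<Sum>m\<in>?K. Const (Poly_Mapping.lookup f m) *
     (\<Prod>i\<in>Poly_Mapping.keys m. s i ^ Poly_Mapping.lookup m i))"
    by (intro subst_extend) auto
  moreover have "subst s g = (\<Sum>m\<in>?K. Const (Poly_Mapping.lookup g m) *
     (\<Prod>i\<in>Poly_Mapping.keys m. s i ^ Poly_Mapping.lookup m i))"
    by (intro subst_extend) auto
  ultimately show ?thesis
    by (simp add: lookup_add Const_add distrib_right sum.distrib)
qed

lemma mpoly_sum_monomials:
  "f = (\<Sum>m\<in>Poly_Mapping.keys f. Poly_Mapping.single m (Poly_Mapping.lookup f m))"
  by (rule poly_mapping_eqI) (auto simp: lookup_sum lookup_single when_def in_keys_iff)

lemma subst_0 [simp]: "subst s 0 = 0"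
  by (simp add: subst_def)

lemma subst_sum: "subst s (\<Sum>x\<in>A. f x) = (\<Sum>x\<in>A. subst s (f x))"
  by (induction A rule: infinite_finite_induct) (auto simp: subst_add)

lemma subst_mult: "subst s (f * g) = subst s f * subst s g"
proof -
  let ?M = "\<lambda>f m. Poly_Mapping.single m (Poly_Mapping.lookup f m)"
  have 1: "subst s (?M f m * ?M g m') = subst s (?M f m) * subst s (?M g m')" for m m'
    by (simp add: mult_single subst_single mono_value_add Const_mult mult_ac)
  have 2: "f * g = (\<Sum>m\<in>Poly_Mapping.keys f. \<Sum>m'\<in>Poly_Mapping.keys g. ?M f m * ?M g m')"
    by (simp only: sum_product[symmetric] mpoly_sum_monomials[symmetric])
  have "subst s (f * g) = (\<Sum>m\<in>Poly_Mapping.keys f. subst s (?M f m)) * (\<Sum>m'\<in>Poly_Mapping.keys g.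
      subst s (?M g m'))"
    by (simp only: 2 subst_sum 1 sum_product)
  then show ?thesis
    by (simp only: subst_sum[symmetric] mpoly_sum_monomials[symmetric])
qed

lemma Const_0 [simp]: "Const 0 = 0"
  by (simp add: Const_def)

lemma Const_1 [simp]: "Const 1 = 1"
  by (simp add: Const_def)

lemma subst_Const [simp]: "subst s (Const c) = Const c"
  unfolding Const_def by (simp add: subst_single mono_value_def) (simp add: Const_def)

lemma subst_1 [simp]: "subst s 1 = 1"
  by (metis Const_1 subst_Const)

lemma subst_Var [simp]: "subst s (Var i) = s i"
  unfolding Var_def by (simp add: subst_single mono_value_def)

lemma comm_ring_hom_subst: "comm_ring_hom (subst s)"
  by unfold_locales (auto simp: subst_add subst_mult)

interpretation subst: comm_ring_hom "subst s" for s
  by (rule comm_ring_hom_subst)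

interpretation Const: comm_ring_hom Const
  by unfold_locales (auto simp: Const_add Const_mult)

lemma Var_power: "(Var i :: 'a::comm_ring_1 mpoly) ^ n =
    Poly_Mapping.single (Poly_Mapping.single i n) 1"
  by (induction n) (auto simp: Var_def mult_single single_add[symmetric] single_one)

lemma prod_single:
  "(\<Prod>i\<in>K. Poly_Mapping.single (f i) (c i::'a::comm_ring_1)) =
      Poly_Mapping.single (\<Sum>i\<in>K. f i :: mono) (\<Prod>i\<in>K. c i)"
  by (induction K rule: infinite_finite_induct) (auto simp: mult_single)

lemma lookup_Const_mult: "Poly_Mapping.lookup (Const (c::'a::comm_ring_1) * f) m =
    c * Poly_Mapping.lookup f m"
  unfolding Const_def mult_map_scale_conv_mult[symmetric]
      by (simp add: Poly_Mapping.map.rep_eq when_def)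

lemma single_eq_Const_mult_mono_value: "Poly_Mapping.single m c = Const c * mono_value Var m"
proof -
  have "(\<Sum>i\<in>Poly_Mapping.keys m. Poly_Mapping.single i (Poly_Mapping.lookup m i)) = m"
    by (rule mpoly_sum_monomials[symmetric])
  then show ?thesis by (simp add: mono_value_def Var_power prod_single Const_def mult_single)
qed

lemma subst_id: "subst Var f = f"
proof -
  have "subst Var f = subst Var (\<Sum>m\<in>Poly_Mapping.keys f. Poly_Mapping.single m
      (Poly_Mapping.lookup f m))"
    by (simp only: mpoly_sum_monomials[symmetric])
  also have "\<dots> = (\<Sum>m\<in>Poly_Mapping.keys f. Poly_Mapping.single m (Poly_Mapping.lookup f m))"
    by (simp add: subst_sum subst_single single_eq_Const_mult_mono_value[symmetric])
  also have "\<dots> = f" by (simp only: mpoly_sum_monomials[symmetric])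
  finally show ?thesis .
qed

text \<open>The universal property of the polynomial ring.\<close>

lemma hom_eq_subst:
  assumes "comm_ring_hom g" "\<And>c. g (Const c) = Const c"
  shows "g f = subst (\<lambda>i. g (Var i)) f"
proof -
  interpret g: comm_ring_hom g by fact
  have "g f = g (subst Var f)" by (simp only: subst_id)
  also have "\<dots> = subst (\<lambda>i. g (Var i)) f"
    by (simp add: subst_def assms(2) g.hom_sum g.hom_mult g.hom_prod g.hom_power)
  finally show ?thesis .
qed

lemma subst_subst: "subst s (subst t f) = subst (\<lambda>i. subst s (t i)) f"
proof -
  have "comm_ring_hom (\<lambda>f. subst s (subst t f))"
    by unfold_locales (auto simp: subst_add subst_mult)
  from hom_eq_subst[OF this] show ?thesis by simp
qed

section \<open>Alternants of products of linear factors\<close>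

text \<open>From here on \<open>$\<close> denotes the coefficients of formal power series.\<close>

no_notation vec_index (infixl "$" 100)
unbundle fps_syntax

text \<open>
  The power series \<open>lin w = 1 - w X\<close> and its inverse \<open>geo w\<close>, the geometric series. Working with
  the variable \<open>X = 1/u\<close> turns expansions at \<open>u = \<infinity>\<close> of rational functions in \<open>u\<close> with roots and
  poles \<open>w\<close> into products of such series.
\<close>

definition lin :: "'a::comm_ring_1 \<Rightarrow> 'a fps" where
  "lin w = 1 - fps_const w * fps_X"

definition geo :: "'a::comm_ring_1 \<Rightarrow> 'a fps" where
  "geo w = Abs_fps (\<lambda>n. w ^ n)"

lemma fps_mult_lin_nth: "(X * lin w) $ n = X $ n - (if n = 0 then 0 else w * X $ (n - 1))"
proof -
  have "X * lin w = X - fps_const w * (X * fps_X)" by (simp add: lin_def algebra_simps)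
  then show ?thesis by (simp add: fps_mult_fps_X_commute)
qed

lemma geo_mult_lin: "geo w * lin w = 1"
proof (rule fps_ext)
  fix n show "(geo w * lin w) $ n = 1 $ n"
    by (cases n) (auto simp: fps_mult_lin_nth, auto simp: geo_def lin_def)
qed

lemma prod_lin_nth_0 [simp]: "prod (\<lambda>i. lin (w i)) I $ 0 = 1"
  by (induction I rule: infinite_finite_induct) (auto simp: lin_def)

lemma prod_geo_nth_0 [simp]: "prod (\<lambda>i. geo (w i)) I $ 0 = 1"
  by (induction I rule: infinite_finite_induct) (auto simp: geo_def)

lemma prod_lin_nth_eq_0:
  assumes "card I < m" "finite I"
  shows "(\<Prod>i\<in>I. lin (w i)) $ m = 0"
  using assms(2,1)
proof (induction arbitrary: m)
  case (insert i I)
  then show ?case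
    by (cases m) (simp_all add: mult.commute[of "lin _"] fps_mult_lin_nth)
qed simp

text \<open>
  The coefficient of \<open>1/u\<close> in \<open>\<Prod>\<^bsub>k<n\<^esub> (u - b\<^sub>k) / (u - w)\<close> is the value of the numerator at \<open>w\<close>.
\<close>

lemma geo_mult_prod_lin_nth:
  "(geo w * (\<Prod>k<n. lin (b k))) $ n = (\<Prod>k<n. w - b k)"
proof (induction n)
  case (Suc n)
  let ?B = "\<Prod>k<n. lin (b k)"
  have "(geo w * ?B) * lin w = geo w * lin w * ?B" by (simp only: mult_ac)
  then have "(geo w * ?B) * lin w = ?B" by (simp add: geo_mult_lin)
  moreover have "?B $ Suc n = 0" by (rule prod_lin_nth_eq_0) auto
  ultimately have "(geo w * ?B * lin w) $ Suc n = 0" by simp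
  then have "(geo w * ?B) $ Suc n = w * (geo w * ?B) $ n"
    by (simp add: fps_mult_lin_nth)
  then have "(geo w * ?B * lin (b n)) $ Suc n = (w - b n) * (geo w * ?B) $ n"
    unfolding fps_mult_lin_nth by (simp add: left_diff_distrib)
  then show ?case using Suc by (simp add: mult_ac)
qed (simp add: geo_def)

text \<open>
  The polynomial \<open>\<Prod>\<^bsub>i<N, i\<noteq>j\<^esub> (u - w\<^sub>i)\<close>, written in the variable \<open>1/u\<close>: the coefficient of
  \<open>u\<^bsup>N-1-r\<^esup>\<close> is the one with index \<open>r\<close>.
\<close>

definition other_factors :: "(nat \<Rightarrow> 'a::comm_ring_1) \<Rightarrow> nat \<Rightarrow> nat \<Rightarrow> 'a fps" where
  "other_factors w N j = (\<Prod>i\<in>{..<N} - {j}. lin (w i))"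

text \<open>
  Evaluation at \<open>w\<^sub>j\<close> of the monic polynomial \<open>f\<close> with roots \<open>b\<^sub>k\<close> is a combination of \<open>N\<close>
  linear functionals of \<open>f\<close> that do not depend on \<open>j\<close>, namely the coefficients of \<open>u\<^bsup>-1\<^esup>\<close> to
  \<open>u\<^bsup>-N\<^esup>\<close> in the expansion of \<open>f(u) / \<Prod>\<^sub>i (u - w\<^sub>i)\<close>. The series \<open>X\<close> is this expansion up to the
  power \<open>u\<^bsup>n-N\<^esup>\<close>, whence the coefficient of \<open>u\<^bsup>-(k+1)\<^esup>\<close> is the one of \<open>X\<close> with index
  \<open>n + k + 1 - N\<close>.
\<close>

lemma expand_at_root:
  fixes w b :: "nat \<Rightarrow> 'a::comm_ring_1"
  assumes X: "X * (\<Prod>i<N. lin (w i)) = (\<Prod>k<n. lin (b k))" and j: "j < N"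
  shows "(\<Prod>k<n. w j - b k) =
    (\<Sum>k<N. (if N \<le> n + Suc k then X $ (n + Suc k - N) else 0) * other_factors w N j $ (N - Suc k))"
proof -
  let ?A = "other_factors w N j"
  have "(\<Prod>i<N. lin (w i)) = lin (w j) * ?A"
    unfolding other_factors_def by (rule prod.remove) (use j in auto)
  then have "geo (w j) * (\<Prod>k<n. lin (b k)) = geo (w j) * lin (w j) * (X * ?A)"
    by (simp add: X[symmetric] mult_ac)
  then have "(\<Prod>k<n. w j - b k) = (X * ?A) $ n"
    using geo_mult_prod_lin_nth[of "w j" b n] by (simp add: geo_mult_lin)
  also have "\<dots> = (\<Sum>r\<le>n. X $ (n - r) * ?A $ r)"
    by (subst mult.commute, subst fps_mult_nth) (simp only: atMost_atLeast0 mult.commute)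
  also have "\<dots> = (\<Sum>r<N. (if r \<le> n then X $ (n - r) else 0) * ?A $ r)"
  proof -
    have "?A $ r = 0" if "r \<ge> N" for r
      unfolding other_factors_def by (rule prod_lin_nth_eq_0) (use j that in auto)
    then show ?thesis
      by (intro sum.mono_neutral_cong) (auto simp: not_less not_le)
  qed
  also have "\<dots> = (\<Sum>k<N. (if N \<le> n + Suc k then X $ (n + Suc k - N) else 0) * ?A $ (N - Suc k))"
    by (subst sum.nat_diff_reindex[symmetric], intro sum.cong refl) (auto intro!: arg_cong2[of _ _
        _ _ "(*)"] arg_cong[of _ _ "fps_nth X"])
  finally show ?thesis .
qed

lemma det_expand_at_roots:
  fixes w :: "nat \<Rightarrow> 'a::comm_ring_1" and b :: "nat \<Rightarrow> nat \<Rightarrow> 'a"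
  assumes "\<And>i. i < N \<Longrightarrow> X i * (\<Prod>i<N. lin (w i)) = (\<Prod>k<n i. lin (b i k))"
  shows "det (mat N N (\<lambda>(i, j). \<Prod>k<n i. w j - b i k)) =
    det (mat N N (\<lambda>(i, k). if N \<le> n i + Suc k then X i $ (n i + Suc k - N) else 0)) *
    det (mat N N (\<lambda>(k, j). other_factors w N j $ (N - Suc k)))" (is "det ?D = det ?E * det ?A")
proof -
  have "?D = ?E * ?A"
  proof (rule eq_matI)
    fix i j assume "i < dim_row (?E * ?A)" "j < dim_col (?E * ?A)"
    then have ij: "i < N" "j < N" by auto
    then show "?D $$ (i, j) = (?E * ?A) $$ (i, j)"
      using expand_at_root[OF assms ij(2), OF ij(1)]
      by (simp add: scalar_prod_def atLeast0LessThan)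
  qed auto
  then show ?thesis
    by (simp only: det_mult[of ?E N] mat_carrier)
qed

text \<open>The Vandermonde product at arbitrary points \<open>w\<close>.\<close>

definition difference_prod :: "(nat \<Rightarrow> 'a::comm_ring_1) \<Rightarrow> nat \<Rightarrow> 'a" where
  "difference_prod w N = (\<Prod>(i, j)\<in>{(i, j). i < j \<and> j < N}. w i - w j)"

lemma difference_prod_alt:
  "difference_prod w N = (\<Prod>i<N. \<Prod>k<N - Suc i. w i - w (N - Suc k))"
proof -
  have "{(i, j). i < j \<and> j < N} = (SIGMA i:{..<N}. {i<..<N})" by auto
  then have "difference_prod w N = (\<Prod>i<N. \<Prod>j\<in>{i<..<N}. w i - w j)"
    by (simp add: difference_prod_def prod.Sigma)
  also have "\<dots> = (\<Prod>i<N. \<Prod>k<N - Suc i. w i - w (N - Suc k))"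
  proof (rule prod.cong[OF refl])
    fix i assume "i \<in> {..<N}"
    show "(\<Prod>j\<in>{i<..<N}. w i - w j) = (\<Prod>k<N - Suc i. w i - w (N - Suc k))"
      by (rule prod.reindex_bij_witness[of _ "\<lambda>k. N - Suc k" "\<lambda>j. N - Suc j"]) auto
  qed
  finally show ?thesis .
qed

lemma prod_lin_mult_geo: "(\<Prod>i\<in>I. lin (w i)) * (\<Prod>i\<in>I. geo (w i)) = 1"
  by (simp add: prod.distrib[symmetric] geo_mult_lin mult.commute[of "lin _"])

text \<open>
  The second factor in \<open>det_expand_at_roots\<close> does not involve the polynomials. It is found by
  taking for the \<open>i\<close>th polynomial the one with the roots \<open>w\<^bsub>i+1\<^esub>\<close> to \<open>w\<^bsub>N-1\<^esub>\<close>: then the matrix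
  of values is lower triangular and the matrix of the functionals is unitriangular.
\<close>

lemma det_other_factors:
  fixes w :: "nat \<Rightarrow> 'a::comm_ring_1"
  shows "det (mat N N (\<lambda>(k, j). other_factors w N j $ (N - Suc k))) = difference_prod w N"
proof -
  define X where "X = (\<lambda>i. (\<Prod>k<N - Suc i. lin (w (N - Suc k))) * (\<Prod>i<N. geo (w i)))"
  let ?D = "mat N N (\<lambda>(i, j). \<Prod>k<N - Suc i. w j - w (N - Suc k))"
  let ?E = "mat N N (\<lambda>(i, k). if N \<le> N - Suc i + Suc k then X i $ (N - Suc i + Suc k - N) else 0)"
  have X: "X i * (\<Prod>i<N. lin (w i)) = (\<Prod>k<N - Suc i. lin (w (N - Suc k)))" for i
  proof -
    have "X i * (\<Prod>i<N. lin (w i)) =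
        (\<Prod>k<N - Suc i. lin (w (N - Suc k))) * ((\<Prod>i<N. lin (w i)) * (\<Prod>i<N. geo (w i)))"
      by (simp only: X_def mult_ac)
    then show ?thesis by (simp only: prod_lin_mult_geo mult_1_right)
  qed
  have "det ?D = prod_list (diag_mat ?D)"
  proof (rule det_lower_triangular)
    fix i j assume "i < j" "j < N"
    then have "N - Suc j < N - Suc i" "w j - w (N - Suc (N - Suc j)) = 0"
      by auto
    then show "?D $$ (i, j) = 0" using \<open>i < j\<close> \<open>j < N\<close>
      by (force intro: prod_zero)
  qed auto
  also have "\<dots> = difference_prod w N"
    by (simp add: difference_prod_alt prod_list_diag_prod atLeast0LessThan)
  finally have D: "det ?D = difference_prod w N" .
  have "det ?E = prod_list (diag_mat ?E)"
    by (rule det_upper_triangular[of _ N]) (auto simp: upper_triangular_def)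
  also have "\<dots> = 1"
    by (auto simp: prod_list_diag_prod X_def intro!: prod.neutral)
  finally have E: "det ?E = 1" .
  show ?thesis
    using det_expand_at_roots[where N = N and X = X and w = w and n = "\<lambda>i. N - Suc i"
        and b = "\<lambda>i k. w (N - Suc k)", OF X] by (simp only: D E mult_1_left)
qed

text \<open>
  The Jacobi--Trudi identity in a commutative ring: the alternant of monic polynomials, given by
  their roots, is the Vandermonde product times a determinant of expansion coefficients.
\<close>

theorem det_prod_differences:
  fixes w :: "nat \<Rightarrow> 'a::comm_ring_1" and b :: "nat \<Rightarrow> nat \<Rightarrow> 'a"
  assumes "\<And>i. i < N \<Longrightarrow> X i * (\<Prod>i<N. lin (w i)) = (\<Prod>k<n i. lin (b i k))"
  shows "det (mat N N (\<lambda>(i, j). \<Prod>k<n i. w j - b i k)) =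
    det (mat N N (\<lambda>(i, k). if N \<le> n i + Suc k then X i $ (n i + Suc k - N) else 0)) *
    difference_prod w N"
  using det_expand_at_roots[where N = N and X = X and w = w and n = n and b = b, OF assms]
      by (simp add: det_other_factors)


section \<open>Young diagrams\<close>

lemma down_closed_eq_lessThan:
  fixes S :: "nat set"
  assumes "finite S" "\<And>i j. j \<in> S \<Longrightarrow> i \<le> j \<Longrightarrow> i \<in> S"
  shows "S = {..<card S}"
proof (cases "S = {}")
  case False
  have "S = {..Max S}"
  proof
    show "S \<subseteq> {..Max S}" using assms(1) by auto
    show "{..Max S} \<subseteq> S" using assms(2)[OF Max_in[OF assms(1) False]] by auto
  qed
  then have "card S = Suc (Max S)" by (metis card_atMost)
  then show ?thesis using \<open>S = {..Max S}\<close> by (simp add: lessThan_Suc_atMost)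
qed simp

lemma young_finite: "\<nu> \<in> young \<Longrightarrow> finite \<nu>"
  unfolding young_def by (drule CollectD) (rule conjunct1)

lemma young_down_closed: "\<nu> \<in> young \<Longrightarrow> (i, j) \<in> \<nu> \<Longrightarrow> i' \<le> i \<Longrightarrow> j' \<le> j \<Longrightarrow> (i', j') \<in> \<nu>"
  unfolding young_def by blast

context
  fixes \<nu> assumes y: "\<nu> \<in> young"
begin

lemma young_mem_iff_row: "(i, j) \<in> \<nu> \<longleftrightarrow> j < row \<nu> i"
proof -
  have "{j. (i, j) \<in> \<nu>} \<subseteq> snd ` \<nu>" by force
  then have "finite {j. (i, j) \<in> \<nu>}"
    by (rule finite_subset) (simp add: young_finite[OF y])
  moreover have "j' \<in> {j. (i, j) \<in> \<nu>}" if "j \<in> {j. (i, j) \<in> \<nu>}" "j' \<le> j" for j j'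
    using young_down_closed[OF y, of i j i j'] that by simp
  ultimately have "{j. (i, j) \<in> \<nu>} = {..<row \<nu> i}"
    unfolding row_def by (rule down_closed_eq_lessThan)
  then show ?thesis by auto
qed

lemma row_antimono: "i \<le> i' \<Longrightarrow> row \<nu> i' \<le> row \<nu> i"
proof (rule ccontr)
  assume "i \<le> i'" "\<not> row \<nu> i' \<le> row \<nu> i"
  then have "(i', row \<nu> i) \<in> \<nu>" "(i, row \<nu> i) \<notin> \<nu>"
    by (auto simp: young_mem_iff_row)
  then show False using young_down_closed[OF y] \<open>i \<le> i'\<close> by blast
qed

lemma row_nonzero_iff: "row \<nu> i \<noteq> 0 \<longleftrightarrow> i < num_rows \<nu>"
proof -
  have "{i. row \<nu> i \<noteq> 0} \<subseteq> fst ` \<nu>"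
    using young_mem_iff_row by (force simp: image_iff)
  then have "finite {i. row \<nu> i \<noteq> 0}"
    by (rule finite_subset) (simp add: young_finite[OF y])
  moreover have "i' \<in> {i. row \<nu> i \<noteq> 0}" if "i \<in> {i. row \<nu> i \<noteq> 0}" "i' \<le> i" for i i'
    using row_antimono[OF that(2)] that(1) by auto
  ultimately have "{i. row \<nu> i \<noteq> 0} = {..<num_rows \<nu>}"
    unfolding num_rows_def by (rule down_closed_eq_lessThan)
  then show ?thesis by auto
qed

lemma row_eq_0: "num_rows \<nu> \<le> i \<Longrightarrow> row \<nu> i = 0"
  using row_nonzero_iff[of i] by auto

lemma card_young_eq_sum_row:
  assumes "num_rows \<nu> \<le> N"
  shows "card \<nu> = (\<Sum>i<N. row \<nu> i)"
proof -
  have "\<nu> = (SIGMA i:{..<N}. {..<row \<nu> i})"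
  proof (rule Set.set_eqI)
    fix b show "b \<in> \<nu> \<longleftrightarrow> b \<in> (SIGMA i:{..<N}. {..<row \<nu> i})"
      using assms row_nonzero_iff[of "fst b"] young_mem_iff_row[of "fst b" "snd b"]
      by (cases b) auto
  qed
  then have "card \<nu> = card (SIGMA i:{..<N}. {..<row \<nu> i})" by simp
  then show ?thesis by simp
qed

lemma num_rows_le_card: "num_rows \<nu> \<le> card \<nu>"
proof -
  have "(\<Sum>i<num_rows \<nu>. 1) \<le> (\<Sum>i<num_rows \<nu>. row \<nu> i)"
    using row_nonzero_iff by (intro sum_mono) (auto simp: Suc_le_eq)
  also have "\<dots> = card \<nu>" by (rule card_young_eq_sum_row[symmetric]) simp
  finally show ?thesis by simp
qed

end

lemma young_eqI:
  assumes "\<nu> \<in> young" "\<mu> \<in> young" "\<And>i. row \<nu> i = row \<mu> i"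
  shows "\<nu> = \<mu>"
proof (rule Set.set_eqI)
  fix b show "b \<in> \<nu> \<longleftrightarrow> b \<in> \<mu>"
    using assms young_mem_iff_row[of _ "fst b" "snd b"] by simp
qed

lemma corners_young:
  assumes "\<nu> \<in> young" "b \<in> corners \<nu>"
  shows "\<nu> - {b} \<in> young" "card (\<nu> - {b}) < card \<nu>"
proof -
  have "b \<in> \<nu>" and y: "\<nu> - {b} \<in> young"
    using assms(2) by (simp_all add: corners_def)
  moreover have "finite \<nu>"
    using assms(1) by (rule young_finite)
  ultimately show "card (\<nu> - {b}) < card \<nu>"
    by (metis card_Diff1_less)
  show "\<nu> - {b} \<in> young" by (rule y)
qed
section \<open>Complete symmetric functions\<close>

text \<open>
  The complete homogeneous symmetric functions \<open>h\<^sub>n\<close> as polynomials in the power sums, by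
  Newton's identity \<open>n h\<^sub>n = \<Sum>\<^bsub>k=1\<^esub>\<^sup>n p\<^sub>k h\<^bsub>n-k\<^esub>\<close>.
\<close>

fun complete_h :: "nat \<Rightarrow> real sym" where
  "complete_h 0 = 1"
| "complete_h (Suc n) = Const (1 / real (Suc n)) * (\<Sum>k\<le>n. Var k * complete_h (n - k))"

lemma fps_deriv_lin: "fps_deriv (lin v) = - (lin v * (fps_const v * geo v))"
proof -
  have "lin v * (fps_const v * geo v) = fps_const v * (geo v * lin v)" by (simp only: mult_ac)
  also have "\<dots> = fps_const v" by (simp only: geo_mult_lin mult_1_right)
  finally have "lin v * (fps_const v * geo v) = fps_const v" .
  moreover have "fps_deriv (lin v) = - fps_const v"
    unfolding lin_def fps_deriv_sub fps_deriv_mult by simp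
  ultimately show ?thesis by (simp only:)
qed

lemma fps_deriv_geo: "fps_deriv (geo w) = geo w * (fps_const w * geo w)"
proof -
  have "geo w * fps_deriv (lin w) + fps_deriv (geo w) * lin w = fps_deriv (geo w * lin w)"
    by (simp only: fps_deriv_mult)
  also have "\<dots> = 0" by (simp add: geo_mult_lin)
  finally have "fps_deriv (geo w) * lin w = - (geo w * fps_deriv (lin w))"
    by (rule minus_unique[symmetric])
  also have "\<dots> = geo w * (lin w * (fps_const w * geo w))"
    by (simp only: fps_deriv_lin minus_minus mult_minus_right)
  also have "\<dots> = (geo w * lin w) * (fps_const w * geo w)"
    by (simp only: mult.assoc)
  finally have *: "fps_deriv (geo w) * lin w = fps_const w * geo w"
    by (simp only: geo_mult_lin mult_1_left)
  have "fps_deriv (geo w) = (geo w * lin w) * fps_deriv (geo w)"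
    by (simp only: geo_mult_lin mult_1_left)
  also have "\<dots> = geo w * (fps_deriv (geo w) * lin w)" by (simp only: mult_ac)
  finally show ?thesis by (simp only: *)
qed

text \<open>The logarithmic derivative of \<open>\<Prod>\<^sub>i (1 - v\<^sub>i X) / (1 - w\<^sub>i X)\<close>.\<close>

lemma fps_deriv_lin_geo_quotient:
  fixes v w :: "nat \<Rightarrow> 'a::comm_ring_1"
  defines "X \<equiv> \<lambda>N. (\<Prod>i<N. lin (v i)) * (\<Prod>i<N. geo (w i))"
  shows "fps_deriv (X N) = X N * (\<Sum>i<N. fps_const (w i) * geo (w i) - fps_const (v i) * geo (v i))"
proof (induction N)
  case (Suc N)
  let ?S = "\<lambda>N. (\<Sum>i<N. fps_const (w i) * geo (w i) - fps_const (v i) * geo (v i))"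
  have X: "X (Suc N) = X N * (lin (v N) * geo (w N))"
    by (simp only: X_def prod.lessThan_Suc mult_ac)
  have "fps_deriv (X (Suc N)) = fps_deriv (X N) * (lin (v N) * geo (w N)) +
      X N * (fps_deriv (lin (v N)) * geo (w N) + lin (v N) * fps_deriv (geo (w N)))"
    unfolding X fps_deriv_mult by (simp only: add.commute)
  also have "\<dots> = X (Suc N) * ?S (Suc N)"
  proof -
    have ring: "(x * s) * (l * g) + x * (- (l * v) * g + l * (g * u)) =
        (x * (l * g)) * (s + (u - v))"
      for x s l g u v :: "'a fps"
      by (simp add: algebra_simps)
    show ?thesis
      unfolding Suc fps_deriv_lin fps_deriv_geo X sum.lessThan_Suc
      by (rule ring)
  qed
  finally show ?case .
qed (simp add: X_def)

text \<open>
  The evaluation \<open>p\<^sub>k \<mapsto> \<Sum>\<^bsub>i<N\<^esub> (w\<^sub>i\<^sup>k - c\<^sub>i\<^sup>k)\<close> at polynomials \<open>w\<^sub>i\<close> and real parameters \<open>c\<^sub>i\<close>;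
  the variable \<open>Var k\<close> stands for \<open>p\<^bsub>k+1\<^esub>\<close>. The parameters are indexed by all integers, since
  the Jacobi--Trudi entries below use negative indices, too.
\<close>

definition super_eval :: "(int \<Rightarrow> real) \<Rightarrow> (nat \<Rightarrow> real mpoly) \<Rightarrow> nat \<Rightarrow> real sym \<Rightarrow> real mpoly" where
  "super_eval c w N = subst (\<lambda>k. \<Sum>i<N. w i ^ Suc k - Const (c (int i) ^ Suc k))"

text \<open>
  The generating series of the \<open>h\<^sub>n\<close> becomes \<open>\<Prod>\<^sub>i (1 - c\<^sub>i X) / (1 - w\<^sub>i X)\<close>: Newton's identity
  is the differential equation that this product satisfies by its logarithmic derivative.
\<close>

lemma super_eval_complete_h:
  fixes w :: "nat \<Rightarrow> real mpoly"
  shows "super_eval c w N (complete_h n) =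
    ((\<Prod>i<N. lin (Const (c (int i)))) * (\<Prod>i<N. geo (w i))) $ n"
    (is "_ = ?X $ n")
proof (induction n rule: less_induct)
  case (less n)
  show ?case
  proof (cases n)
    case 0
    then show ?thesis by (simp add: super_eval_def)
  next
    case (Suc m)
    let ?s = "\<lambda>k. \<Sum>i<N. w i ^ Suc k - Const (c (int i) ^ Suc k)"
    let ?S = "\<Sum>i<N. fps_const (w i) * geo (w i) - fps_const (Const (c (int i))) * geo (Const (c
        (int i)))"
    have S: "?S $ k = ?s k" for k
      by (simp add: fps_sum_nth geo_def Const.hom_power Const_mult)
    have "of_nat (Suc m) * ?X $ Suc m = fps_deriv ?X $ m" by (simp only: fps_deriv_nth Suc_eq_plus1)
    also have "\<dots> = (?S * ?X) $ m" by (simp only: fps_deriv_lin_geo_quotient mult.commute[of ?S])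
    also have "\<dots> = (\<Sum>k\<le>m. ?s k * ?X $ (m - k))"
      by (subst fps_mult_nth) (simp only: S atMost_atLeast0)
    also have "\<dots> = (\<Sum>k\<le>m. ?s k * super_eval c w N (complete_h (m - k)))"
      using less Suc by simp
    finally have *: "of_nat (Suc m) * ?X $ Suc m =
        (\<Sum>k\<le>m. ?s k * super_eval c w N (complete_h (m - k)))" .
    have "Const (1 / real (Suc m)) * of_nat (Suc m) =
        (Const (1 / real (Suc m) * real (Suc m)) :: real mpoly)"
      by (simp only: Const.hom_mult Const.hom_of_nat)
    then have **: "Const (1 / real (Suc m)) * of_nat (Suc m) = (1 :: real mpoly)" by simp
    have "super_eval c w N (complete_h n) = Const (1 / real (Suc m)) *
        (\<Sum>k\<le>m. ?s k * super_eval c w N (complete_h (m - k)))"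
      by (simp add: Suc super_eval_def subst_mult subst_sum)
    also have "\<dots> = Const (1 / real (Suc m)) * of_nat (Suc m) * ?X $ Suc m"
      by (simp only: *[symmetric] mult.assoc)
    also have "\<dots> = ?X $ Suc m"
      by (simp only: ** mult_1_left)
    finally show ?thesis using Suc by simp
  qed
qed

lemma super_eval_complete_h_fps:
  "Abs_fps (\<lambda>n. super_eval c w N (complete_h n)) * (\<Prod>i<N. lin (w i)) =
      (\<Prod>i<N. lin (Const (c (int i))))"
proof -
  have "Abs_fps (\<lambda>n. super_eval c w N (complete_h n)) =
    (\<Prod>i<N. lin (Const (c (int i)))) * (\<Prod>i<N. geo (w i))"
    by (rule fps_ext) (simp add: super_eval_complete_h)
  then have "Abs_fps (\<lambda>n. super_eval c w N (complete_h n)) * (\<Prod>i<N. lin (w i)) =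
     (\<Prod>i<N. lin (Const (c (int i)))) * ((\<Prod>i<N. lin (w i)) * (\<Prod>i<N. geo (w i)))"
    by (simp only: mult_ac)
  then show ?thesis by (simp only: prod_lin_mult_geo mult_1_right)
qed


section \<open>Multiparameter Schur functions\<close>

definition map_fps :: "('a \<Rightarrow> 'b) \<Rightarrow> 'a fps \<Rightarrow> 'b fps" where
  "map_fps g X = Abs_fps (\<lambda>n. g (X $ n))"

context comm_ring_hom
begin

lemma map_fps_mult: "map_fps hom (X * Y) = map_fps hom X * map_fps hom Y"
  by (rule fps_ext) (simp add: map_fps_def fps_mult_nth hom_sum hom_mult)

lemma map_fps_1: "map_fps hom 1 = 1"
  by (rule fps_ext) (simp add: map_fps_def)

lemma map_fps_prod: "map_fps hom (\<Prod>i\<in>I. X i) = (\<Prod>i\<in>I. map_fps hom (X i))"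
  by (induction I rule: infinite_finite_induct) (simp_all add: map_fps_mult map_fps_1)

lemma map_fps_lin: "map_fps hom (lin a) = lin (hom a)"
  by (rule fps_ext) (simp add: map_fps_def lin_def hom_mult hom_minus)

lemma map_fps_geo: "map_fps hom (geo a) = geo (hom a)"
  by (rule fps_ext) (simp add: map_fps_def geo_def hom_power)

end

text \<open>
  The expansion at \<open>u = \<infinity>\<close>, without its leading power of \<open>u\<close>, of
  \<open>\<Prod>\<^bsub>k < \<nu>\<^sub>i\<^esub> (u - c\<^bsub>i-k\<^esub>) / \<Prod>\<^bsub>j \<le> i\<^esub> (u - c\<^sub>j)\<close>. Enlarging \<open>N\<close> multiplies
  \<open>\<Prod>\<^bsub>k < \<nu>\<^sub>i + N - 1 - i\<^esub> (u - c\<^bsub>N-1-k\<^esub>)\<close> and \<open>\<Prod>\<^bsub>j<N\<^esub> (u - c\<^sub>j)\<close> by the same factors, so that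
  their quotient is this rational function for every \<open>N > i\<close> (\<open>row_factor_mult\<close>).
\<close>

definition row_factor :: "(int \<Rightarrow> real) \<Rightarrow> (nat \<times> nat) set \<Rightarrow> nat \<Rightarrow> real sym fps" where
  "row_factor c \<nu> i = (\<Prod>k<row \<nu> i. lin (Const (c (int i - int k)))) * (\<Prod>j<Suc i. geo (Const (c
      (int j))))"

text \<open>
  For \<open>c = 0\<close> the entry is \<open>h\<close> with the index \<open>\<nu>\<^sub>i - i + k\<close>, as in the Jacobi--Trudi identity.
\<close>

definition jt_entry :: "(int \<Rightarrow> real) \<Rightarrow> (nat \<times> nat) set \<Rightarrow> nat \<Rightarrow> nat \<Rightarrow> real sym" where
  "jt_entry c \<nu> i k = (if i \<le> row \<nu> i + k
     then (row_factor c \<nu> i * Abs_fps complete_h) $ (row \<nu> i + k - i) else 0)"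

text \<open>The multiparameter Schur function for the parameters \<open>c\<^sub>j\<close>.\<close>

definition multi_schur :: "(int \<Rightarrow> real) \<Rightarrow> (nat \<times> nat) set \<Rightarrow> real sym" where
  "multi_schur c \<nu> = det (mat (num_rows \<nu>) (num_rows \<nu>) (\<lambda>(i, k). jt_entry c \<nu> i k))"

lemma row_factor_mult:
  assumes "i < N"
  shows "row_factor c \<nu> i * (\<Prod>j<N. lin (Const (c (int j)))) =
    (\<Prod>k<row \<nu> i + (N - Suc i). lin (Const (c (int N - 1 - int k))))"
proof -
  from assms have "Suc i \<le> N" by simp
  then show ?thesis
  proof (induction N rule: dec_induct)
    case base
    have "row_factor c \<nu> i * (\<Prod>j<Suc i. lin (Const (c (int j)))) =
       (\<Prod>k<row \<nu> i. lin (Const (c (int i - int k)))) *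
       ((\<Prod>j<Suc i. lin (Const (c (int j)))) * (\<Prod>j<Suc i. geo (Const (c (int j)))))"
      unfolding row_factor_def by (simp only: mult_ac)
    then show ?case by (simp only: prod_lin_mult_geo) simp
  next
    case (step N)
    have n: "row \<nu> i + (Suc N - Suc i) = Suc (row \<nu> i + (N - Suc i))" using step.hyps by simp
    have "row_factor c \<nu> i * (\<Prod>j<Suc N. lin (Const (c (int j)))) =
       (row_factor c \<nu> i * (\<Prod>j<N. lin (Const (c (int j))))) * lin (Const (c (int N)))"
      by (simp only: prod.lessThan_Suc mult_ac)
    also have "\<dots> = (\<Prod>k<row \<nu> i + (N - Suc i). lin (Const (c (int N - 1 - int k)))) * lin (Const (c
        (int N)))"
      by (simp only: step.IH)
    also have "\<dots> = (\<Prod>k<Suc (row \<nu> i + (N - Suc i)). lin (Const (c (int (Suc N) - 1 - int k))))"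
      by (subst prod.lessThan_Suc_shift) (simp add: mult.commute algebra_simps)
    finally show ?case by (simp only: n)
  qed
qed

lemma map_fps_subst_row_factor: "map_fps (subst s) (row_factor c \<nu> i) = row_factor c \<nu> i"
  by (simp add: row_factor_def subst.map_fps_mult subst.map_fps_prod subst.map_fps_lin
      subst.map_fps_geo)

text \<open>
  In the rows below the last nonempty row of \<open>\<nu>\<close> the Jacobi--Trudi matrix has \<open>1\<close> on the
  diagonal and \<open>0\<close> left of it, whence its size may be enlarged.
\<close>

lemma det_jt_stable:
  assumes y: "\<nu> \<in> young" and N: "num_rows \<nu> \<le> N"
  shows "det (mat N N (\<lambda>(i, k). jt_entry c \<nu> i k)) = multi_schur c \<nu>"
  using N
proof (induction N rule: dec_induct)
  case base
  then show ?case by (simp add: multi_schur_def)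
next
  case (step N)
  let ?M = "\<lambda>N. mat N N (\<lambda>(i, k). jt_entry c \<nu> i k)"
  have row: "jt_entry c \<nu> N k = (if k = N then 1 else 0)" if "k \<le> N" for k
    using that row_eq_0[OF y step.hyps(1)]
    by (auto simp: jt_entry_def row_factor_def fps_mult_nth_0 simp del: prod.lessThan_Suc)
  have "det (?M (Suc N)) = (\<Sum>j<Suc N. ?M (Suc N) $$ (N, j) * cofactor (?M (Suc N)) N j)"
    by (rule laplace_expansion_row) auto
  also have "\<dots> = cofactor (?M (Suc N)) N N"
    by (simp add: row)
  also have "\<dots> = det (mat_delete (?M (Suc N)) N N)"
    by (simp add: cofactor_def power_add[symmetric] mult_2[symmetric])
  also have "mat_delete (?M (Suc N)) N N = ?M N"
    by (rule eq_matI) (auto simp: mat_delete_def)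
  finally show ?case by (simp add: step.IH)
qed

text \<open>
  In \<open>N \<ge> \<ell>(\<nu>)\<close> variables the multiparameter Schur function is a quotient of alternants.
\<close>

theorem super_eval_multi_schur:
  assumes y: "\<nu> \<in> young" and N: "num_rows \<nu> \<le> N"
  shows "super_eval c w N (multi_schur c \<nu>) * difference_prod w N =
    det (mat N N (\<lambda>(i, j). \<Prod>k<row \<nu> i + (N - Suc i). w j - Const (c (int N - 1 - int k))))"
proof -
  interpret e: comm_ring_hom "super_eval c w N"
    unfolding super_eval_def by (rule comm_ring_hom_subst)
  define X where "X = (\<lambda>i. map_fps (super_eval c w N) (row_factor c \<nu> i * Abs_fps complete_h))"
  have X: "X i * (\<Prod>i<N. lin (w i)) =
     (\<Prod>k<row \<nu> i + (N - Suc i). lin (Const (c (int N - 1 - int k))))" if "i < N" for i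
  proof -
    have "map_fps (super_eval c w N) (row_factor c \<nu> i) = row_factor c \<nu> i"
      unfolding super_eval_def by (rule map_fps_subst_row_factor)
    moreover have "map_fps (super_eval c w N) (Abs_fps complete_h) =
        Abs_fps (\<lambda>n. super_eval c w N (complete_h n))"
      by (simp add: map_fps_def)
    ultimately have "X i = row_factor c \<nu> i * Abs_fps (\<lambda>n. super_eval c w N (complete_h n))"
      by (simp only: X_def e.map_fps_mult)
    then show ?thesis
      by (simp only: mult.assoc super_eval_complete_h_fps row_factor_mult[OF that])
  qed
  have "super_eval c w N (multi_schur c \<nu>) =
    det (mat N N (\<lambda>(i, k). super_eval c w N (jt_entry c \<nu> i k)))"
    unfolding det_jt_stable[OF y N, symmetric] e.hom_det[symmetric]
    by (intro arg_cong[of _ _ det] eq_matI) auto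
  also have "mat N N (\<lambda>(i, k). super_eval c w N (jt_entry c \<nu> i k)) =
    mat N N (\<lambda>(i, k). if N \<le> (row \<nu> i + (N - Suc i)) + Suc k
         then X i $ ((row \<nu> i + (N - Suc i)) + Suc k - N) else 0)"
    by (intro eq_matI)
       (auto simp: jt_entry_def X_def map_fps_def intro!: arg_cong[of _ _
           "super_eval c w N"] arg_cong[of _ _ "fps_nth _"])
  finally show ?thesis
    using det_prod_differences[where N = N and X = X and w = w and n = "\<lambda>i. row \<nu> i + (N - Suc i)"
      and b = "\<lambda>i k. Const (c (int N - 1 - int k))", OF X] by simp
qed


section \<open>Leading monomials of alternants\<close>

text \<open>The exponent vector of \<open>\<Prod>\<^bsub>j<N\<^esub> Var j ^ \<alpha> j\<close>.\<close>

definition expo :: "(nat \<Rightarrow> nat) \<Rightarrow> nat \<Rightarrow> mono" where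
  "expo \<alpha> N = (\<Sum>j<N. Poly_Mapping.single j (\<alpha> j))"

lemma lookup_expo: "Poly_Mapping.lookup (expo \<alpha> N) i = (if i < N then \<alpha> i else 0)"
  by (simp add: expo_def lookup_sum lookup_single when_def)

lemma expo_eq_iff: "expo \<alpha> N = expo \<beta> N \<longleftrightarrow> (\<forall>j<N. \<alpha> j = \<beta> j)"
proof
  assume "expo \<alpha> N = expo \<beta> N"
  then show "\<forall>j<N. \<alpha> j = \<beta> j" by (metis lookup_expo)
qed (simp add: expo_def)

lemma lookup_prod_univariate:
  fixes a :: "nat \<Rightarrow> nat \<Rightarrow> 'a::comm_ring_1"
  assumes "\<And>j. j < N \<Longrightarrow> \<alpha> j \<le> R"
  shows "Poly_Mapping.lookup (\<Prod>j<N. \<Sum>r\<le>R. Const (a j r) * Var j ^ r) (expo \<alpha> N) = (\<Prod>j<N. a j (\<alpha> j))"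
proof -
  let ?P = "PiE {..<N} (\<lambda>_. {..R})"
  let ?\<alpha> = "restrict \<alpha> {..<N}"
  have "(\<Prod>j<N. \<Sum>r\<le>R. Const (a j r) * Var j ^ r) =
      (\<Prod>j<N. \<Sum>r\<le>R. Poly_Mapping.single (Poly_Mapping.single j r) (a j r))"
    by (simp add: Const_def Var_power mult_single)
  also have "\<dots> = (\<Sum>g\<in>?P. Poly_Mapping.single (expo g N) (\<Prod>j<N. a j (g j)))"
    by (simp add: prod_sum_PiE prod_single expo_def)
  finally have "Poly_Mapping.lookup (\<Prod>j<N. \<Sum>r\<le>R. Const (a j r) * Var j ^ r) (expo \<alpha> N) =
     (\<Sum>g\<in>?P. if expo g N = expo \<alpha> N then \<Prod>j<N. a j (g j) else 0)"
    by (simp add: lookup_sum lookup_single when_def)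
  also have "\<dots> = (\<Sum>g\<in>?P. if g = ?\<alpha> then \<Prod>j<N. a j (\<alpha> j) else 0)"
  proof (rule sum.cong[OF refl])
    fix g assume "g \<in> ?P"
    then have "expo g N = expo \<alpha> N \<longleftrightarrow> g = ?\<alpha>"
      unfolding expo_eq_iff by (auto simp: PiE_def extensional_def fun_eq_iff)
    then show "(if expo g N = expo \<alpha> N then \<Prod>j<N. a j (g j) else 0) =
      (if g = ?\<alpha> then \<Prod>j<N. a j (\<alpha> j) else 0)" by simp
  qed
  also have "\<dots> = (\<Prod>j<N. a j (\<alpha> j))"
    using assms by (simp add: finite_PiE)
  finally show ?thesis .
qed

lemma monic_expansion:
  fixes \<gamma> :: "nat \<Rightarrow> 'a::comm_ring_1"
  shows "\<exists>a. a n = 1 \<and> (\<forall>r>n. a r = 0) \<and> (\<forall>R\<ge>n. \<forall>w. (\<Prod>k<n. w - Const (\<gamma> k)) =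
      (\<Sum>r\<le>R. Const (a r) * w ^ r))"
proof (induction n)
  case 0
  show ?case
  proof (intro exI[of _ "\<lambda>r. if r = 0 then 1 else 0"] conjI allI impI)
    fix R and w :: "'a mpoly"
    have "(\<Sum>r\<le>R. Const (if r = 0 then 1 else 0) * w ^ r) = (\<Sum>r\<in>{0}. Const (if r =
        0 then 1 else 0) * w ^ r)"
      by (rule sum.mono_neutral_right) auto
    then show "(\<Prod>k<0. w - Const (\<gamma> k)) = (\<Sum>r\<le>R. Const (if r = 0 then 1 else 0) * w ^ r)" by simp
  qed auto
next
  case (Suc n)
  then obtain a where a: "a n = 1" "\<And>r. r > n \<Longrightarrow> a r = 0"
    "\<And>R w. R \<ge> n \<Longrightarrow> (\<Prod>k<n. w - Const (\<gamma> k)) = (\<Sum>r\<le>R. Const (a r) * w ^ r)" by blast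
  let ?b = "\<lambda>r. (if r = 0 then 0 else a (r - 1)) - \<gamma> n * a r"
  show ?case
  proof (intro exI[of _ ?b] conjI allI impI)
    fix R and w :: "'a mpoly" assume R: "Suc n \<le> R"
    then obtain Q where Q: "R = Suc Q" "n \<le> Q" by (cases R) auto
    have "(\<Prod>k<Suc n. w - Const (\<gamma> k)) = w * (\<Prod>k<n. w - Const (\<gamma> k)) - Const (\<gamma> n) * (\<Prod>k<n. w -
        Const (\<gamma> k))"
      by (simp add: algebra_simps)
    also have "\<dots> = w * (\<Sum>r\<le>Q. Const (a r) * w ^ r) - Const (\<gamma> n) * (\<Sum>r\<le>R. Const (a r) * w ^ r)"
      using a(3)[of Q w] a(3)[of R w] Q by simp
    also have "w * (\<Sum>r\<le>Q. Const (a r) * w ^ r) = (\<Sum>r\<le>R. Const (if r =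
        0 then 0 else a (r - 1)) * w ^ r)"
      unfolding Q(1) sum.atMost_Suc_shift by (simp add: sum_distrib_left mult_ac)
    finally show "(\<Prod>k<Suc n. w - Const (\<gamma> k)) = (\<Sum>r\<le>R. Const (?b r) * w ^ r)"
      by (simp add: sum_distrib_left sum_subtractf[symmetric] Const.hom_minus Const_mult
          left_diff_distrib mult.assoc)
  qed (use a in auto)
qed

lemma lookup_signof_mult:
  "Poly_Mapping.lookup (signof p * f) m = signof p * Poly_Mapping.lookup (f :: 'a::comm_ring_1
      mpoly) m"
  by (simp add: sign_def)

lemma permutes_eq_id_of_strict_mono:
  fixes p :: "nat \<Rightarrow> nat"
  assumes p: "p permutes {..<N}" and mono: "\<And>i j. i < j \<Longrightarrow> j < N \<Longrightarrow> p i < p j"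
  shows "p = id"
proof (rule permutes_natset_ge[OF p], rule ballI)
  fix i assume "i \<in> {..<N}"
  then have "i < N" by simp
  then show "i \<le> p i"
  proof (induction i)
    case (Suc i)
    then show ?case using mono[of i "Suc i"] by simp
  qed simp
qed

text \<open>
  For strictly decreasing exponents \<open>n\<close>, the alternant of monic polynomials of degrees \<open>n\<^sub>i\<close>
  contains \<open>\<Prod>\<^sub>j x\<^sub>j ^ n\<^sub>j\<close> with coefficient \<open>1\<close>, and no other monomial with strictly decreasing
  exponents whose total degree is at least that of \<open>n\<close>. The \<open>i\<close>th polynomial has the roots \<open>\<gamma>\<^sub>k\<close>
  for \<open>k < n\<^sub>i\<close>.
\<close>

lemma lookup_det_alternant:
  fixes \<gamma> :: "nat \<Rightarrow> 'a::comm_ring_1"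
  assumes n: "\<And>i j. i < j \<Longrightarrow> j < N \<Longrightarrow> n j < n i" and \<alpha>: "\<And>i j. i < j \<Longrightarrow> j < N \<Longrightarrow> \<alpha> j < \<alpha> i"
    and le: "(\<Sum>i<N. n i) \<le> (\<Sum>i<N. \<alpha> i)"
  shows "Poly_Mapping.lookup (det (mat N N (\<lambda>(i, j). \<Prod>k<n i. Var j - Const (\<gamma> k)))) (expo \<alpha> N) =
    (if \<forall>i<N. n i = \<alpha> i then 1 else 0)" (is "Poly_Mapping.lookup (det ?D) _ = _")
proof -
  have "\<forall>m. \<exists>a. a m = 1 \<and> (\<forall>r>m. a r = 0) \<and> (\<forall>R\<ge>m. \<forall>w. (\<Prod>k<m. w - Const (\<gamma> k)) =
      (\<Sum>r\<le>R. Const (a r) * w ^ r))"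
    by (intro allI monic_expansion)
  from choice[OF this] obtain a where *: "\<forall>m. a m m = 1 \<and> (\<forall>r>m. a m r = 0) \<and>
      (\<forall>R\<ge>m. \<forall>w. (\<Prod>k<m. w - Const (\<gamma> k)) = (\<Sum>r\<le>R. Const (a m r) * w ^ r))" ..
  have a: "a m m = 1" "r > m \<Longrightarrow> a m r = 0"
    "R \<ge> m \<Longrightarrow> (\<Prod>k<m. w - Const (\<gamma> k)) = (\<Sum>r\<le>R. Const (a m r) * w ^ r)" for m r R w
    using *[rule_format, of m] by simp_all
  define R where "R = (\<Sum>i<N. n i) + (\<Sum>i<N. \<alpha> i)"
  have R: "n i \<le> R" "\<alpha> i \<le> R" if "i < N" for i
  proof -
    have "n i \<le> (\<Sum>i<N. n i)" "\<alpha> i \<le> (\<Sum>i<N. \<alpha> i)" using that by (auto intro!: member_le_sum)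
    then show "n i \<le> R" "\<alpha> i \<le> R" by (simp_all add: R_def)
  qed
  \<comment> \<open>With the transposed matrix a permutation \<open>p\<close> assigns the polynomial \<open>p j\<close> to the variable \<open>j\<close>.\<close>
  let ?T = "mat N N (\<lambda>(j, i). \<Prod>k<n i. Var j - Const (\<gamma> k))"
  have "?T = transpose_mat ?D" by (rule eq_matI) auto
  then have "det ?D = det ?T" using det_transpose[of ?D N] by simp
  also have "\<dots> = (\<Sum>p | p permutes {0..<N}. signof p * (\<Prod>j = 0..<N. ?T $$ (j, p j)))"
    by (rule det_def') simp
  finally have "Poly_Mapping.lookup (det ?D) (expo \<alpha> N) =
    (\<Sum>p | p permutes {..<N}. signof p * Poly_Mapping.lookup (\<Prod>j<N. ?T $$ (j, p j)) (expo \<alpha> N))"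
    by (simp only: lookup_sum lookup_signof_mult atLeast0LessThan)
  also have "\<dots> = (\<Sum>p | p permutes {..<N}. if p = id then (if \<forall>i<N. n i = \<alpha> i then 1 else 0) else 0)"
  proof (rule sum.cong[OF refl])
    fix p assume "p \<in> {p. p permutes {..<N}}"
    then have p: "p permutes {..<N}" by simp
    then have pN: "p j < N" if "j < N" for j using permutes_in_image[OF p, of j] that by simp
    have "(\<Prod>j<N. ?T $$ (j, p j)) = (\<Prod>j<N. \<Sum>r\<le>R. Const (a (n (p j)) r) * Var j ^ r)"
      by (intro prod.cong refl) (simp add: pN R a(3)[symmetric])
    then have L: "Poly_Mapping.lookup (\<Prod>j<N. ?T $$ (j, p j)) (expo \<alpha> N) = (\<Prod>j<N. a (n (p j)) (\<alpha> j))"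
      by (simp only:) (rule lookup_prod_univariate, rule R)
    show "signof p * Poly_Mapping.lookup (\<Prod>j<N. ?T $$ (j, p j)) (expo \<alpha> N) =
      (if p = id then (if \<forall>i<N. n i = \<alpha> i then 1 else 0) else 0)"
    proof (cases "\<forall>j<N. \<alpha> j \<le> n (p j)")
      case False
      then obtain j where "j < N" "a (n (p j)) (\<alpha> j) = 0" using a(2) by (meson linorder_not_le)
      then have "(\<Prod>j<N. a (n (p j)) (\<alpha> j)) = 0" by (intro prod_zero) auto
      moreover from False have "\<not> (p = id \<and> (\<forall>i<N. n i = \<alpha> i))" by auto
      ultimately show ?thesis using L by auto
    next
      case True
      have "(\<Sum>j<N. n (p j)) = (\<Sum>j<N. n j)" using sum.permute[OF p, of n] by (simp add: o_def)
      with le have le': "(\<Sum>j<N. n (p j)) \<le> (\<Sum>j<N. \<alpha> j)" by simp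
      have eq: "n (p j) = \<alpha> j" if "j < N" for j
      proof (rule ccontr)
        assume "n (p j) \<noteq> \<alpha> j"
        with True that have "\<alpha> j < n (p j)" by (simp add: order_less_le)
        with True that have "(\<Sum>j<N. \<alpha> j) < (\<Sum>j<N. n (p j))"
          by (intro sum_strict_mono_ex1) auto
        with le' show False by simp
      qed
      \<comment> \<open>Both \<open>n\<close> and \<open>\<alpha> = n \<circ> p\<close> are strictly decreasing, so \<open>p\<close> is increasing.\<close>
      have "p i < p j" if "i < j" "j < N" for i j
      proof (rule ccontr)
        assume "\<not> p i < p j"
        moreover have "p i \<noteq> p j" using permutes_inj[OF p] that by (auto dest: injD)
        ultimately have "p j < p i" by simp
        then have "n (p i) < n (p j)" using n pN that by simp
        then show False using \<alpha>[OF that] eq that by auto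
      qed
      then have "p = id" by (rule permutes_eq_id_of_strict_mono[OF p])
      then show ?thesis using L eq a(1) by (auto simp: sign_id)
    qed
  qed
  also have "\<dots> = (if \<forall>i<N. n i = \<alpha> i then 1 else 0)"
    by (subst sum.delta) (auto simp: finite_permutations permutes_id)
  finally show ?thesis .
qed


section \<open>Weights and leading parts\<close>

lemma weight_extend:
  assumes "finite K" "Poly_Mapping.keys m \<subseteq> K"
  shows "weight m = (\<Sum>k\<in>K. Suc k * Poly_Mapping.lookup m k)"
  unfolding weight_def using assms
  by (intro sum.mono_neutral_left) (auto simp: in_keys_iff)

lemma weight_add: "weight (m + m') = weight m + weight m'"
proof -
  let ?K = "Poly_Mapping.keys m \<union> Poly_Mapping.keys m'"
  have "Poly_Mapping.keys (m + m') \<subseteq> ?K" by (rule keys_add)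
  then have "weight (m + m') = (\<Sum>k\<in>?K. Suc k * Poly_Mapping.lookup (m + m') k)"
    by (intro weight_extend) auto
  also have "\<dots> = (\<Sum>k\<in>?K. Suc k * Poly_Mapping.lookup m k) + (\<Sum>k\<in>?K. Suc k * Poly_Mapping.lookup m'
      k)"
    by (simp add: lookup_add add_mult_distrib2 sum.distrib)
  also have "\<dots> = weight m + weight m'"
    by (simp add: weight_extend[of ?K])
  finally show ?thesis .
qed

text \<open>
  Homogeneity of weight \<open>d\<close>, and having only terms of weight less than \<open>d\<close>. The weight is
  allowed to be any integer because the nominal weight \<open>\<nu>\<^sub>i - i + k\<close> of a vanishing
  Jacobi--Trudi entry may be negative; the zero polynomial satisfies both conditions for all
  \<open>d\<close>.
\<close>

definition graded :: "int \<Rightarrow> 'a::zero mpoly \<Rightarrow> bool" where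
  "graded d f \<longleftrightarrow> (\<forall>m\<in>Poly_Mapping.keys f. int (weight m) = d)"

definition below :: "int \<Rightarrow> 'a::zero mpoly \<Rightarrow> bool" where
  "below d f \<longleftrightarrow> (\<forall>m\<in>Poly_Mapping.keys f. int (weight m) < d)"

lemma graded_0 [simp]: "graded d 0" and below_0 [simp]: "below d 0"
  by (auto simp: graded_def below_def)

lemma sym_upto_iff_below: "f \<in> sym_upto n \<longleftrightarrow> below (int n + 1) f"
  by (auto simp: sym_upto_def below_def)

lemma graded_imp_below: "graded d f \<Longrightarrow> d < e \<Longrightarrow> below e f"
  by (auto simp: graded_def below_def)

lemma below_mono: "below d f \<Longrightarrow> d \<le> e \<Longrightarrow> below e f"
  by (force simp: below_def)

lemma keys_diff_mpoly: "Poly_Mapping.keys (f - g) \<subseteq> Poly_Mapping.keys f \<union> Poly_Mapping.keys (g ::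
    'a::comm_ring_1 mpoly)"
  by (auto simp: in_keys_iff lookup_minus)

lemma graded_add: "graded d f \<Longrightarrow> graded d g \<Longrightarrow> graded d (f + g)"
  unfolding graded_def using keys_add[of f g] by blast

lemma below_add: "below d f \<Longrightarrow> below d g \<Longrightarrow> below d (f + g)"
  unfolding below_def using keys_add[of f g] by blast

lemma graded_sum: "(\<And>x. x \<in> A \<Longrightarrow> graded d (f x)) \<Longrightarrow> graded d (sum f A)"
  by (induction A rule: infinite_finite_induct) (auto simp: graded_add)

lemma below_sum: "(\<And>x. x \<in> A \<Longrightarrow> below d (f x)) \<Longrightarrow> below d (sum f A)"
  by (induction A rule: infinite_finite_induct) (auto simp: below_add)

lemma graded_mult:
  assumes "graded d f" "graded e g" shows "graded (d + e) (f * g :: 'a::comm_ring_1 mpoly)"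
  unfolding graded_def
proof
  fix m assume "m \<in> Poly_Mapping.keys (f * g)"
  then obtain a b where "m = a + b" "a \<in> Poly_Mapping.keys f" "b \<in> Poly_Mapping.keys g"
    using keys_mult[of f g] by blast
  then show "int (weight m) = d + e" using assms by (auto simp: graded_def weight_add)
qed

lemma below_mult:
  assumes "below d f" "below e g" shows "below (d + e - 1) (f * g :: 'a::comm_ring_1 mpoly)"
  unfolding below_def
proof
  fix m assume "m \<in> Poly_Mapping.keys (f * g)"
  then obtain a b where "m = a + b" "a \<in> Poly_Mapping.keys f" "b \<in> Poly_Mapping.keys g"
    using keys_mult[of f g] by blast
  moreover then have "int (weight a) < d" "int (weight b) < e" using assms by (auto simp: below_def)
  ultimately show "int (weight m) < d + e - 1" by (simp add: weight_add)
qed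

lemma graded_Const [simp]: "graded 0 (Const c)"
  by (auto simp: graded_def Const_def weight_def split: if_splits)

lemma graded_1 [simp]: "graded 0 1"
  by (simp add: graded_def weight_def)

lemma graded_Var: "graded (int k + 1) (Var k :: 'a::comm_ring_1 mpoly)"
  by (simp add: graded_def Var_def weight_def)

text \<open>\<open>g\<close> is the homogeneous part of weight \<open>d\<close> of \<open>f\<close>, and \<open>f\<close> has no terms of greater weight.\<close>

definition leading_part :: "int \<Rightarrow> 'a::comm_ring_1 mpoly \<Rightarrow> 'a mpoly \<Rightarrow> bool" where
  "leading_part d f g \<longleftrightarrow> graded d g \<and> below d (f - g)"

lemma leading_part_refl: "graded d f \<Longrightarrow> leading_part d f f"
  by (simp add: leading_part_def)

lemma leading_part_imp_below: "leading_part d f g \<Longrightarrow> below (d + 1) f"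
  using below_add[of "d + 1" "f - g" g] below_mono[of d "f - g" "d + 1"] graded_imp_below[of d g
      "d + 1"]
  by (simp add: leading_part_def)

lemma leading_part_mult:
  assumes "leading_part d f g" "leading_part e f' g'"
  shows "leading_part (d + e) (f * f') (g * g')"
proof -
  have "f * f' - g * g' = (f - g) * f' + g * (f' - g')" by (simp add: algebra_simps)
  moreover have "below (d + e) ((f - g) * f')"
    using below_mult[of d "f - g" "e + 1" f'] leading_part_imp_below[OF assms(2)] assms(1)
    by (simp add: leading_part_def)
  moreover have "below (d + e) (g * (f' - g'))"
    using below_mult[of "d + 1" g e "f' - g'"] graded_imp_below[of d g "d + 1"] assms
    by (simp add: leading_part_def)
  ultimately show ?thesis
    using assms graded_mult[of d g e g'] by (simp add: leading_part_def below_add)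
qed

lemma leading_part_prod:
  assumes "finite I" "\<And>i. i \<in> I \<Longrightarrow> leading_part (d i) (f i) (g i)"
  shows "leading_part (\<Sum>i\<in>I. d i) (\<Prod>i\<in>I. f i) (\<Prod>i\<in>I. g i)"
  using assms
proof (induction I rule: finite_induct)
  case empty
  show ?case by (simp add: leading_part_refl)
qed (simp add: leading_part_mult)

lemma leading_part_sum:
  assumes "\<And>i. i \<in> I \<Longrightarrow> leading_part d (f i) (g i)"
  shows "leading_part d (\<Sum>i\<in>I. f i) (\<Sum>i\<in>I. g i)"
  using assms unfolding leading_part_def
  by (auto simp: sum_subtractf[symmetric] intro: graded_sum below_sum)

lemma graded_complete_h: "graded (int n) (complete_h n)"
proof (induction n rule: less_induct)
  case (less n)
  show ?case
  proof (cases n)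
    case 0
    then show ?thesis by simp
  next
    case (Suc m)
    have "graded (int n) (\<Sum>k\<le>m. Var k * complete_h (m - k))"
    proof (rule graded_sum)
      fix k assume "k \<in> {..m}"
      then show "graded (int n) (Var k * complete_h (m - k))"
        using graded_mult[OF graded_Var[of k] less[of "m - k"]] Suc by (simp add: of_nat_diff)
    qed
    from graded_mult[OF graded_Const this] show ?thesis by (simp add: Suc)
  qed
qed

text \<open>All coefficients of the series are constant polynomials.\<close>

definition const_fps :: "'a::comm_ring_1 mpoly fps \<Rightarrow> bool" where
  "const_fps X \<longleftrightarrow> (\<forall>n. graded 0 (X $ n))"

lemma const_fps_mult: "const_fps X \<Longrightarrow> const_fps Y \<Longrightarrow> const_fps (X * Y)"
  unfolding const_fps_def fps_mult_nth using graded_mult[of 0 _ 0] by (auto intro!: graded_sum)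

lemma const_fps_1: "const_fps 1"
  by (simp add: const_fps_def fps_one_nth)

lemma const_fps_prod: "(\<And>i. i \<in> I \<Longrightarrow> const_fps (X i)) \<Longrightarrow> const_fps (\<Prod>i\<in>I. X i)"
  by (induction I rule: infinite_finite_induct) (simp_all add: const_fps_mult const_fps_1)

lemma const_fps_lin: "const_fps (lin (Const v))"
proof -
  have "lin (Const v) $ n = Const (if n = 0 then 1 else if n = 1 then - v else 0)" for n
    by (cases n) (auto simp: lin_def Const.hom_minus Const.hom_uminus)
  then show ?thesis by (simp add: const_fps_def)
qed

lemma const_fps_geo: "const_fps (geo (Const v))"
  by (simp add: const_fps_def geo_def Const.hom_power[symmetric])

lemma const_fps_row_factor: "const_fps (row_factor c \<nu> i)"
  unfolding row_factor_def by (intro const_fps_mult const_fps_prod const_fps_lin const_fps_geo)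

lemma row_factor_0: "row_factor (\<lambda>_. 0) \<nu> i = 1"
proof -
  have "lin 0 = (1 :: real sym fps)" "geo 0 = (1 :: real sym fps)"
    using geo_mult_lin[of "0 :: real sym"] by (simp_all add: lin_def)
  then show ?thesis by (simp add: row_factor_def del: prod.lessThan_Suc)
qed

lemma leading_part_jt_entry:
  "leading_part (int (row \<nu> i) + int k - int i) (jt_entry c \<nu> i k) (jt_entry (\<lambda>_. 0) \<nu> i k)"
proof (cases "i \<le> row \<nu> i + k")
  case False
  then show ?thesis by (simp add: jt_entry_def leading_part_def)
next
  case True
  define d where "d = row \<nu> i + k - i"
  have d: "int (row \<nu> i) + int k - int i = int d" using True by (simp add: d_def)
  have "row_factor c \<nu> i $ 0 = 1" by (simp add: row_factor_def del: prod.lessThan_Suc)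
  then have 1: "jt_entry c \<nu> i k = complete_h d + (\<Sum>r=1..d. row_factor c \<nu> i $ r * complete_h (d -
      r))"
    using True by (simp add: jt_entry_def d_def[symmetric] fps_mult_nth sum.atLeast_Suc_atMost)
  have 0: "jt_entry (\<lambda>_. 0) \<nu> i k = complete_h d"
    using True by (simp add: jt_entry_def d_def row_factor_0)
  have "below (int d) (\<Sum>r=1..d. row_factor c \<nu> i $ r * complete_h (d - r))"
  proof (rule below_sum)
    fix r assume r: "r \<in> {1..d}"
    have "graded (0 + int (d - r)) (row_factor c \<nu> i $ r * complete_h (d - r))"
      using const_fps_row_factor unfolding const_fps_def
          by (intro graded_mult graded_complete_h) auto
    then show "below (int d) (row_factor c \<nu> i $ r * complete_h (d - r))"
      by (rule graded_imp_below) (use r in auto)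
  qed
  then show ?thesis
    unfolding d 0 1 leading_part_def using graded_complete_h by simp
qed

lemma leading_part_multi_schur:
  assumes y: "\<nu> \<in> young"
  shows "leading_part (int (card \<nu>)) (multi_schur c \<nu>) (multi_schur (\<lambda>_. 0) \<nu>)"
proof -
  let ?L = "num_rows \<nu>"
  have det: "multi_schur c \<nu> = (\<Sum>p | p permutes {..<?L}. signof p * (\<Prod>i<?L. jt_entry c \<nu> i (p
      i)))" for c
  proof -
    have "multi_schur c \<nu> = (\<Sum>p | p permutes {0..<?L}. signof p *
      (\<Prod>i=0..<?L. mat ?L ?L (\<lambda>(i, k). jt_entry c \<nu> i k) $$ (i, p i)))"
      unfolding multi_schur_def by (rule det_def') simp
    also have "\<dots> = (\<Sum>p | p permutes {..<?L}. signof p * (\<Prod>i<?L. jt_entry c \<nu> i (p i)))"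
      unfolding atLeast0LessThan
    proof (intro sum.cong arg_cong2[of _ _ _ _ "(*)"] prod.cong refl)
      fix p i assume "p \<in> {p. p permutes {..<?L}}" "i \<in> {..<?L}"
      then show "mat ?L ?L (\<lambda>(i, k). jt_entry c \<nu> i k) $$ (i, p i) = jt_entry c \<nu> i (p i)"
        using permutes_in_image[of p "{..<?L}" i] by simp
    qed
    finally show ?thesis .
  qed
  show ?thesis
    unfolding det
  proof (rule leading_part_sum)
    fix p assume "p \<in> {p. p permutes {..<?L}}"
    then have p: "p permutes {..<?L}" by simp
    \<comment> \<open>The weights of the entries add up to \<open>\<Sum>\<^sub>i (\<nu>\<^sub>i + p i - i) = |\<nu>|\<close> for each permutation.\<close>
    have "(\<Sum>i<?L. int (p i)) = (\<Sum>i<?L. int i)" using sum.permute[OF p, of int] by (simp add: o_def)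
    then have "(\<Sum>i<?L. int (row \<nu> i) + int (p i) - int i) = int (card \<nu>)"
      by (simp add: sum.distrib sum_subtractf card_young_eq_sum_row[OF y order_refl])
    moreover have "leading_part (\<Sum>i<?L. int (row \<nu> i) + int (p i) - int i)
       (\<Prod>i<?L. jt_entry c \<nu> i (p i)) (\<Prod>i<?L. jt_entry (\<lambda>_. 0) \<nu> i (p i))"
      by (rule leading_part_prod) (auto intro: leading_part_jt_entry)
    ultimately have "leading_part (int (card \<nu>)) (\<Prod>i<?L. jt_entry c \<nu> i (p i)) (\<Prod>i<?L. jt_entry
        (\<lambda>_. 0) \<nu> i (p i))"
      by simp
    moreover have "leading_part 0 (signof p :: real sym) (signof p)"
      using graded_Const[of "1 :: real"] graded_Const[of "-1 :: real"]
      by (intro leading_part_refl) (simp add: sign_def Const.hom_uminus)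
    ultimately show "leading_part (int (card \<nu>)) (signof p * (\<Prod>i<?L. jt_entry c \<nu> i (p i)))
      (signof p * (\<Prod>i<?L. jt_entry (\<lambda>_. 0) \<nu> i (p i)))"
      using leading_part_mult[of 0] by fastforce
  qed
qed


section \<open>Bases by counting\<close>

text \<open>The Young diagrams with at most \<open>n\<close> boxes.\<close>

definition young_upto :: "nat \<Rightarrow> (nat \<times> nat) set set" where
  "young_upto n = {\<nu> \<in> young. card \<nu> \<le> n}"

lemma finite_young_upto: "finite (young_upto n)"
proof (rule finite_subset)
  show "young_upto n \<subseteq> Pow ({..<n} \<times> {..<n})"
  proof (clarsimp simp: young_upto_def)
    fix \<nu> i j assume y: "\<nu> \<in> young" and n: "card \<nu> \<le> n" and ij: "(i, j) \<in> \<nu>"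
    have f: "finite \<nu>" using y by (rule young_finite)
    have "(\<lambda>i'. (i', j)) ` {..i} \<subseteq> \<nu>" "(\<lambda>j'. (i, j')) ` {..j} \<subseteq> \<nu>"
      using young_down_closed[OF y ij] by auto
    from this[THEN card_mono[OF f]] show "i < n \<and> j < n"
      using n by (auto simp: card_image inj_on_def)
  qed
qed simp

text \<open>
  A monomial \<open>\<Prod>\<^sub>k p\<^bsub>k+1\<^esub> ^ m\<^sub>k\<close> determines the diagram with \<open>m\<^sub>k\<close> rows of length \<open>k + 1\<close>; it is
  described by its column lengths \<open>\<Sum>\<^bsub>k \<ge> j\<^esub> m\<^sub>k\<close>, from which the monomial is recovered by taking
  differences.
\<close>

definition mono_diagram :: "mono \<Rightarrow> (nat \<times> nat) set" where
  "mono_diagram m = {(i, j). i < (\<Sum>k\<in>Poly_Mapping.keys m \<inter> {j..}. Poly_Mapping.lookup m k)}"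

lemma mono_diagram_extend:
  assumes "\<And>k. k \<in> Poly_Mapping.keys m \<Longrightarrow> k < K"
  shows "(i, j) \<in> mono_diagram m \<longleftrightarrow> i < (\<Sum>k\<in>{j..<K}. Poly_Mapping.lookup m k)"
proof -
  have "(\<Sum>k\<in>Poly_Mapping.keys m \<inter> {j..}. Poly_Mapping.lookup m k) =
      (\<Sum>k\<in>{j..<K}. Poly_Mapping.lookup m k)"
    using assms by (intro sum.mono_neutral_left) (auto simp: in_keys_iff)
  then show ?thesis by (simp add: mono_diagram_def)
qed

lemma mono_diagram_young: "mono_diagram m \<in> young" (is ?A)
  and card_mono_diagram: "card (mono_diagram m) = weight m" (is ?B)
proof -
  define K where "K = Suc (Max (insert 0 (Poly_Mapping.keys m)))"
  have K: "k < K" if "k \<in> Poly_Mapping.keys m" for k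
    using that by (simp add: K_def le_imp_less_Suc)
  let ?c = "\<lambda>j. \<Sum>k\<in>{j..<K}. Poly_Mapping.lookup m k"
  note mem = mono_diagram_extend[of m K, OF K]
  have eq: "mono_diagram m = prod.swap ` (SIGMA j:{..<K}. {..<?c j})"
  proof (rule Set.set_eqI)
    fix b show "b \<in> mono_diagram m \<longleftrightarrow> b \<in> prod.swap ` (SIGMA j:{..<K}. {..<?c j})"
      by (cases b, cases "snd b < K") (auto simp: mem image_iff)
  qed
  have "finite (mono_diagram m)" by (simp add: eq)
  moreover have "(i', j') \<in> mono_diagram m" if "(i, j) \<in> mono_diagram m" "i' \<le> i" "j' \<le>
      j" for i j i' j'
  proof -
    have "?c j \<le> ?c j'" by (rule sum_mono2) (use that in auto)
    then show ?thesis using that by (simp add: mem)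
  qed
  ultimately show ?A unfolding young_def by blast
  have "card (mono_diagram m) = (\<Sum>j<K. ?c j)"
    unfolding eq by (subst card_image) simp_all
  also have "\<dots> = (\<Sum>j<K. \<Sum>k<K. if j \<le> k then Poly_Mapping.lookup m k else 0)"
  proof (rule sum.cong[OF refl])
    fix j assume "j \<in> {..<K}"
    have "{..<K} \<inter> {k. j \<le> k} = {j..<K}" by auto
    then show "?c j = (\<Sum>k<K. if j \<le> k then Poly_Mapping.lookup m k else 0)"
      by (simp add: sum.If_cases)
  qed
  also have "\<dots> = (\<Sum>k<K. \<Sum>j<K. if j \<le> k then Poly_Mapping.lookup m k else 0)"
    by (rule sum.swap)
  also have "\<dots> = (\<Sum>k<K. Suc k * Poly_Mapping.lookup m k)"
  proof (rule sum.cong[OF refl])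
    fix k assume "k \<in> {..<K}"
    then have "{..<K} \<inter> {j. j \<le> k} = {..k}" by auto
    then show "(\<Sum>j<K. if j \<le> k then Poly_Mapping.lookup m k else 0) =
        Suc k * Poly_Mapping.lookup m k"
      by (simp add: sum.If_cases)
  qed
  also have "\<dots> = weight m" by (rule weight_extend[symmetric]) (use K in auto)
  finally show ?B .
qed

lemma inj_mono_diagram: "inj mono_diagram"
proof (rule injI)
  fix m m' assume eq: "mono_diagram m = mono_diagram m'"
  define K where "K = Suc (Max (insert 0 (Poly_Mapping.keys m \<union> Poly_Mapping.keys m')))"
  have K: "k \<in> Poly_Mapping.keys m \<Longrightarrow> k < K" "k \<in> Poly_Mapping.keys m' \<Longrightarrow> k < K" for k
    by (simp_all add: K_def le_imp_less_Suc)
  have c: "(\<Sum>k\<in>{j..<K}. Poly_Mapping.lookup m k) = (\<Sum>k\<in>{j..<K}. Poly_Mapping.lookup m' k)" for j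
  proof -
    have "i < (\<Sum>k\<in>{j..<K}. Poly_Mapping.lookup m k) \<longleftrightarrow> i < (\<Sum>k\<in>{j..<K}. Poly_Mapping.lookup m' k)"
        for i
      using mono_diagram_extend[of m K, OF K(1), of i j] mono_diagram_extend[of m' K, OF K(2), of
          i j] eq by simp
    then show ?thesis by (meson linorder_neq_iff)
  qed
  show "m = m'"
  proof (rule poly_mapping_eqI)
    fix j show "Poly_Mapping.lookup m j = Poly_Mapping.lookup m' j"
    proof (cases "j < K")
      case True
      then show ?thesis using c[of j] c[of "Suc j"] by (simp add: sum.atLeast_Suc_lessThan)
    next
      case False
      then show ?thesis using K[of j] by (metis in_keys_iff)
    qed
  qed
qed

lemma card_mono_le_card_young:
  "finite {m. weight m \<le> n} \<and> card {m. weight m \<le> n} \<le> card (young_upto n)"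
proof -
  have inj: "inj_on mono_diagram {m. weight m \<le> n}"
    using inj_mono_diagram by (rule inj_on_subset) simp
  have sub: "mono_diagram ` {m. weight m \<le> n} \<subseteq> young_upto n"
    by (auto simp: young_upto_def mono_diagram_young card_mono_diagram)
  have "finite (mono_diagram ` {m. weight m \<le> n})"
    using sub finite_young_upto by (rule finite_subset)
  then show ?thesis
    using inj sub finite_young_upto by (auto dest: finite_imageD intro: card_inj_on_le)
qed

text \<open>
  In enough variables even the images of distinct multiparameter Schur functions are linearly
  independent: after multiplication by the Vandermonde product, the leading monomial of a
  diagram \<open>\<rho>\<close> of maximal size among those with nonzero coefficient occurs in no other alternant
  of these.
\<close>

lemma super_eval_multi_schur_independent:
  assumes S: "finite S" "S \<subseteq> young" "\<And>\<nu>. \<nu> \<in> S \<Longrightarrow> num_rows \<nu> \<le> N"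
    and 0: "super_eval c Var N (\<Sum>\<nu>\<in>S. Const (x \<nu>) * multi_schur c \<nu>) = 0" and \<nu>: "\<nu> \<in> S"
  shows "x \<nu> = 0"
proof (rule ccontr)
  assume nz: "x \<nu> \<noteq> 0"
  define T where "T = {\<mu>\<in>S. x \<mu> \<noteq> 0}"
  have T: "finite T" "T \<noteq> {}" using S(1) \<nu> nz by (auto simp: T_def)
  have "Max (card ` T) \<in> card ` T" using T by (intro Max_in) auto
  then obtain \<rho> where \<rho>T: "\<rho> \<in> T" and "card \<rho> = Max (card ` T)" by force
  then have max: "card \<mu> \<le> card \<rho>" if "\<mu> \<in> T" for \<mu> using T(1) that by simp
  let ?e = "\<lambda>\<mu> i. row \<mu> i + (N - Suc i)"
  have dec: "?e \<mu> j < ?e \<mu> i" if "\<mu> \<in> S" "i < j" "j < N" for \<mu> i j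
    using row_antimono[of \<mu> i j] that S(2) by auto
  have sum_e: "(\<Sum>i<N. ?e \<mu> i) = card \<mu> + (\<Sum>i<N. N - Suc i)" if "\<mu> \<in> S" for \<mu>
  proof -
    have "card \<mu> = (\<Sum>i<N. row \<mu> i)"
      by (rule card_young_eq_sum_row) (use S that in auto)
    then show ?thesis by (simp only: sum.distrib)
  qed
  let ?D = "\<lambda>\<mu>. det (mat N N (\<lambda>(i, j). \<Prod>k<?e \<mu> i. Var j - Const (c (int N - 1 - int k))))"
  have lookup_D: "Poly_Mapping.lookup (?D \<mu>) (expo (?e \<rho>) N) = (if \<mu> = \<rho> then 1 else 0)" if \<mu>:
      "\<mu> \<in> T" for \<mu>
  proof -
    have \<mu>S: "\<mu> \<in> S" "\<rho> \<in> S" using \<mu> \<rho>T by (auto simp: T_def)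
    have "Poly_Mapping.lookup (?D \<mu>) (expo (?e \<rho>) N) = (if \<forall>i<N. ?e \<mu> i = ?e \<rho> i then 1 else 0)"
      by (rule lookup_det_alternant) (use dec \<mu>S sum_e max[OF \<mu>] in auto)
    also have "(\<forall>i<N. ?e \<mu> i = ?e \<rho> i) \<longleftrightarrow> \<mu> = \<rho>"
    proof
      assume *: "\<forall>i<N. ?e \<mu> i = ?e \<rho> i"
      show "\<mu> = \<rho>"
      proof (rule young_eqI)
        fix i show "row \<mu> i = row \<rho> i"
        proof (cases "i < N")
          case False
          then show ?thesis
            using S \<mu>S row_eq_0[of \<mu> i] row_eq_0[of \<rho> i]
                by (metis linorder_not_less order_trans subsetD)
        qed (use * in auto)
      qed (use S \<mu>S in auto)
    qed simp
    finally show ?thesis .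
  qed
  have spec_Const: "super_eval c Var N (Const r * f) = Const r * super_eval c Var N f" for r f
    by (simp add: super_eval_def subst_mult)
  have "0 = super_eval c Var N (\<Sum>\<mu>\<in>S. Const (x \<mu>) * multi_schur c \<mu>) * difference_prod Var N"
    using 0 by simp
  also have "\<dots> = (\<Sum>\<mu>\<in>S. super_eval c Var N (Const (x \<mu>) * multi_schur c \<mu>)) * difference_prod Var N"
    by (simp only: super_eval_def subst_sum)
  also have "\<dots> = (\<Sum>\<mu>\<in>S. Const (x \<mu>) * (super_eval c Var N (multi_schur c \<mu>) * difference_prod Var
      N))"
    by (simp only: spec_Const sum_distrib_right mult.assoc)
  also have "\<dots> = (\<Sum>\<mu>\<in>S. Const (x \<mu>) * ?D \<mu>)"
    using S by (intro sum.cong refl arg_cong2[of _ _ _ _ "(*)"] super_eval_multi_schur) auto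
  also have "\<dots> = (\<Sum>\<mu>\<in>T. Const (x \<mu>) * ?D \<mu>)"
    using S(1) by (intro sum.mono_neutral_right) (auto simp: T_def)
  finally have "0 = Poly_Mapping.lookup (\<Sum>\<mu>\<in>T. Const (x \<mu>) * ?D \<mu>) (expo (?e \<rho>) N)" by simp
  also have "\<dots> = (\<Sum>\<mu>\<in>T. x \<mu> * Poly_Mapping.lookup (?D \<mu>) (expo (?e \<rho>) N))"
    by (simp add: lookup_sum lookup_Const_mult)
  also have "\<dots> = (\<Sum>\<mu>\<in>T. if \<mu> = \<rho> then x \<rho> else 0)"
    by (intro sum.cong refl) (simp add: lookup_D)
  also have "\<dots> = x \<rho>" using T \<rho>T by simp
  finally show False using \<rho>T by (simp add: T_def)
qed


context vector_space
begin

lemma independent_imp_spanning_by_card: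
  assumes B: "independent B" "finite B" "B \<subseteq> span T" and T: "finite T" "card T \<le> card B"
  shows "T \<subseteq> span B"
proof (rule ccontr)
  assume "\<not> T \<subseteq> span B"
  then obtain t where t: "t \<in> T" "t \<notin> span B" by blast
  have "independent (insert t B)" using t(2) B(1) by (rule independent_insertI)
  moreover have "insert t B \<subseteq> span T" using t(1) B(3) by (auto intro: span_base)
  ultimately have "card (insert t B) \<le> card T"
    using independent_span_bound[OF T(1)] by blast
  moreover have "t \<notin> B" using t(2) span_base by blast
  ultimately show False using B(2) T(2) by simp
qed

lemma spanning_imp_independent_by_card:
  assumes T: "independent T" "T \<subseteq> span B" and B: "finite B" "card B \<le> card T"
  shows "independent B"
proof
  assume "dependent B"
  then obtain b where b: "b \<in> B" "b \<in> span (B - {b})" unfolding dependent_def by blast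
  have "span B = span (B - {b})"
    using span_redundant[OF b(2)] b(1) by (simp add: insert_absorb)
  then have "card T \<le> card (B - {b})"
    using independent_span_bound[of "B - {b}" T] T B(1) by simp
  also have "\<dots> < card B" using b(1) B(1) by (metis card_Diff1_less)
  finally show False using B(2) by simp
qed

end

text \<open>\<open>Sym\<close> as a vector space over the real numbers.\<close>

interpretation real_sym: vector_space "\<lambda>c (f :: real sym). Const c * f"
  by unfold_locales (simp_all add: Const_add Const_mult algebra_simps)

text \<open>The power-sum monomials of weight at most \<open>n\<close>.\<close>

abbreviation monomials_upto :: "nat \<Rightarrow> 'a::zero_neq_one sym set" where
  "monomials_upto n \<equiv> (\<lambda>m. Poly_Mapping.single m 1) ` {m. weight m \<le> n}"

lemma sym_upto_in_span_monomials: "sym_upto n \<subseteq> real_sym.span (monomials_upto n)"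
proof
  fix f :: "real sym" assume f: "f \<in> sym_upto n"
  have "f = (\<Sum>m\<in>Poly_Mapping.keys f. Const (Poly_Mapping.lookup f m) * Poly_Mapping.single m 1)"
    by (subst mpoly_sum_monomials) (simp add: Const_def mult_single)
  moreover have "(\<Sum>m\<in>Poly_Mapping.keys f. Const (Poly_Mapping.lookup f m) * Poly_Mapping.single m 1)
      \<in> real_sym.span (monomials_upto n)"
    using f by (intro real_sym.span_sum real_sym.span_scale real_sym.span_base) (auto simp:
        sym_upto_def)
  ultimately show "f \<in> real_sym.span (monomials_upto n)" by simp
qed

lemma multi_schur_in_sym_upto: "\<nu> \<in> young_upto n \<Longrightarrow> multi_schur c \<nu> \<in> sym_upto n"
  using leading_part_imp_below[OF leading_part_multi_schur[of \<nu> c]]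
  by (auto simp: sym_upto_iff_below young_upto_def elim: below_mono)

lemma num_rows_young_upto: "\<nu> \<in> young_upto n \<Longrightarrow> num_rows \<nu> \<le> n"
  using num_rows_le_card[of \<nu>] by (simp add: young_upto_def)

lemma inj_on_multi_schur: "inj_on (multi_schur c) (young_upto n)"
proof (rule inj_onI, rule ccontr)
  fix \<nu> \<mu> assume *: "\<nu> \<in> young_upto n" "\<mu> \<in> young_upto n" "multi_schur c \<nu> = multi_schur c \<mu>"
      "\<nu> \<noteq> \<mu>"
  let ?x = "\<lambda>\<kappa>. if \<kappa> = \<nu> then 1 else - 1 :: real"
  have "(\<Sum>\<kappa>\<in>{\<nu>, \<mu>}. Const (?x \<kappa>) * multi_schur c \<kappa>) = 0"
    using * by (simp add: Const.hom_uminus)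
  then have "?x \<nu> = 0"
    by (intro super_eval_multi_schur_independent[of "{\<nu>, \<mu>}" n c ?x])
       (use * num_rows_young_upto in \<open>auto simp: young_upto_def super_eval_def\<close>)
  then show False by simp
qed

lemma independent_multi_schur: "real_sym.independent (multi_schur c ` young_upto n)"
proof -
  have "\<forall>f\<in>multi_schur c ` young_upto n. u f = 0"
    if 0: "(\<Sum>f\<in>multi_schur c ` young_upto n. Const (u f) * f) = 0" for u
  proof safe
    fix \<nu> assume \<nu>: "\<nu> \<in> young_upto n"
    have "(\<Sum>\<nu>\<in>young_upto n. Const (u (multi_schur c \<nu>)) * multi_schur c \<nu>) = 0"
      using 0 by (simp add: sum.reindex[OF inj_on_multi_schur])
    then show "u (multi_schur c \<nu>) = 0"
      by (intro super_eval_multi_schur_independent[of "young_upto n" n c "\<lambda>\<nu>. u (multi_schur c \<nu>)"])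
         (use \<nu> finite_young_upto num_rows_young_upto in \<open>auto simp: young_upto_def super_eval_def\<close>)
  qed
  then show ?thesis
    by (subst real_sym.dependent_finite) (use finite_young_upto in blast)+
qed

lemma card_multi_schur: "card (multi_schur c ` young_upto n) = card (young_upto n)"
  by (rule card_image[OF inj_on_multi_schur])

lemma card_monomials_upto: "card (monomials_upto n :: 'a::zero_neq_one sym set) =
    card {m. weight m \<le> n}"
  by (intro card_image inj_onI) (drule arg_cong[of _ _ Poly_Mapping.keys], simp)

lemma finite_monomials_upto: "finite (monomials_upto n)"
  using card_mono_le_card_young by simp

lemma multi_schur_subset_span_monomials:
  "multi_schur c ` young_upto n \<subseteq> real_sym.span (monomials_upto n)"
  using multi_schur_in_sym_upto sym_upto_in_span_monomials by blast

text \<open>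
  One inequality is the injection of monomials into diagrams; the other one follows from linear
  independence, without constructing the inverse map.
\<close>

lemma card_young_eq_card_mono: "card (young_upto n) = card {m. weight m \<le> n}"
proof (rule antisym)
  show "card (young_upto n) \<le> card {m. weight m \<le> n}"
    using real_sym.independent_span_bound[OF finite_monomials_upto independent_multi_schur
       multi_schur_subset_span_monomials]
    by (metis card_multi_schur card_monomials_upto)
qed (use card_mono_le_card_young in blast)

theorem sym_upto_span_multi_schur: "sym_upto n \<subseteq> real_sym.span (multi_schur c ` young_upto n)"
proof -
  have "monomials_upto n \<subseteq> real_sym.span (multi_schur c ` young_upto n)"
    by (rule real_sym.independent_imp_spanning_by_card)
       (simp_all add: independent_multi_schur finite_young_upto finite_monomials_upto
         multi_schur_subset_span_monomials card_multi_schur card_monomials_upto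
             card_young_eq_card_mono)
  then have "real_sym.span (monomials_upto n) \<subseteq> real_sym.span (multi_schur c ` young_upto n)"
    by (rule real_sym.span_minimal) (rule real_sym.subspace_span)
  then show ?thesis using sym_upto_in_span_monomials by blast
qed

lemma sym_upto_exists: "\<exists>n. f \<in> sym_upto n"
proof
  show "f \<in> sym_upto (Max (insert 0 (weight ` Poly_Mapping.keys f)))"
    by (simp add: sym_upto_def)
qed

text \<open>
  For each choice of the parameters \<open>c\<close>, a symmetric function is determined by its evaluations
  at the variables \<open>w\<^sub>i = Var i\<close> for all \<open>N\<close>.
\<close>

theorem super_eval_eq_0_imp:
  assumes "\<And>N. super_eval c Var N f = 0"
  shows "f = 0"
proof -
  obtain n where "f \<in> sym_upto n" using sym_upto_exists by blast
  then have "f \<in> real_sym.span (multi_schur c ` young_upto n)" using sym_upto_span_multi_schur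
      by blast
  then obtain u where "f = (\<Sum>g\<in>multi_schur c ` young_upto n. Const (u g) * g)"
    using real_sym.span_finite[of "multi_schur c ` young_upto n"] finite_young_upto by auto
  then have f: "f = (\<Sum>\<nu>\<in>young_upto n. Const (u (multi_schur c \<nu>)) * multi_schur c \<nu>)"
    by (simp add: sum.reindex[OF inj_on_multi_schur])
  have "u (multi_schur c \<nu>) = 0" if "\<nu> \<in> young_upto n" for \<nu>
    using assms[of n] that
    by (intro super_eval_multi_schur_independent[of "young_upto n" n c "\<lambda>\<nu>. u (multi_schur c \<nu>)"])
       (use finite_young_upto num_rows_young_upto f in \<open>auto simp: young_upto_def\<close>)
  then show ?thesis using f by simp
qed


section \<open>Schur functions and Frobenius--Schur functions\<close>

lemma super_eval_subst: "subst s (super_eval c w N f) = super_eval c (\<lambda>i. subst s (w i)) N f"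
  by (simp add: super_eval_def subst_subst subst_sum subst.hom_minus subst.hom_power subst.hom_mult)

lemma super_eval_cong: "(\<And>i. i < N \<Longrightarrow> w i = w' i) \<Longrightarrow> super_eval c w N f = super_eval c w' N f"
  unfolding super_eval_def by (intro arg_cong[of _ _ "\<lambda>s. subst s f"] ext sum.cong) auto

lemma super_eval_drop:
  assumes "w N = Const (c (int N))"
  shows "super_eval c w (Suc N) f = super_eval c w N f"
  unfolding super_eval_def by (simp add: assms Const.hom_power Const_mult)

text \<open>
  In the variables \<open>y\<^sub>i = w\<^sub>i - c\<^sub>i\<close>, setting \<open>y\<^sub>N = 0\<close> cancels the summand \<open>w\<^sub>N\<^sup>k - c\<^sub>N\<^sup>k\<close>,
  which makes the evaluations for different \<open>N\<close> compatible.
\<close>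

abbreviation shifted_Var :: "(int \<Rightarrow> real) \<Rightarrow> nat \<Rightarrow> real mpoly" where
  "shifted_Var c i \<equiv> Var i + Const (c (int i))"

lemma super_eval_stable:
  assumes "N \<le> M"
  shows "super_eval c (shifted_Var c) N f =
    subst (\<lambda>i. if i < N then Var i else 0) (super_eval c (shifted_Var c) M f)"
  using assms
proof (induction M rule: dec_induct)
  case base
  show ?case unfolding super_eval_subst by (rule super_eval_cong) (simp add: subst_add)
next
  case (step M)
  have "subst (\<lambda>i. if i < N then Var i else 0) (super_eval c (shifted_Var c) (Suc M) f) =
    super_eval c (\<lambda>i. subst (\<lambda>i. if i < N then Var i else 0) (shifted_Var c i)) (Suc M) f"
    by (rule super_eval_subst)
  also have "\<dots> = super_eval c (\<lambda>i. subst (\<lambda>i. if i < N then Var i else 0) (shifted_Var c i)) M f"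
    by (rule super_eval_drop) (use step.hyps in \<open>simp add: subst_add\<close>)
  also have "\<dots> = subst (\<lambda>i. if i < N then Var i else 0) (super_eval c (shifted_Var c) M f)"
    by (rule super_eval_subst[symmetric])
  finally show ?case using step.IH by simp
qed

lemma lookup_Var_single:
  "Poly_Mapping.lookup (Var j :: 'a::zero_neq_one mpoly) (Poly_Mapping.single i (Suc 0)) = (if i =
      j then 1 else 0)"
proof -
  have "Poly_Mapping.single j (Suc 0) = Poly_Mapping.single i (Suc 0) \<longleftrightarrow> i = j"
    by (metis keys_single nat.distinct(1) singleton_insert_inj_eq)
  then show ?thesis by (auto simp: Var_def lookup_single when_def)
qed

lemma lookup_Const_single:
  "Poly_Mapping.lookup (Const c) (Poly_Mapping.single i (Suc 0)) = 0"
proof -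
  have "Poly_Mapping.single i (Suc 0) \<noteq> 0"
    by (metis keys_single keys_zero nat.distinct(1) insert_not_empty)
  then show ?thesis by (auto simp: Const_def lookup_single when_def)
qed

text \<open>
  For \<open>N = \<ell>(\<nu>) - 1\<close> one adds the point \<open>w\<^sub>N = c\<^sub>N\<close>, which does not affect the evaluation. In
  the alternant of size \<open>N + 1\<close> every entry of the last column then has the factor \<open>w\<^sub>N - c\<^sub>N\<close>,
  whereas the Vandermonde product does not vanish. Smaller \<open>N\<close> follow by compatibility.
\<close>

lemma super_eval_multi_schur_eq_0:
  assumes y: "\<nu> \<in> young" and N: "N < num_rows \<nu>"
  shows "super_eval c (shifted_Var c) N (multi_schur c \<nu>) = 0"
proof -
  obtain M where M: "num_rows \<nu> = Suc M" "N \<le> M" using N by (cases "num_rows \<nu>") auto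
  define w where "w = (\<lambda>i. if i < M then shifted_Var c i else Const (c (int i)))"
  let ?A = "mat (Suc M) (Suc M) (\<lambda>(i, j). \<Prod>k<row \<nu> i + (Suc M - Suc i). w j - Const (c (int (Suc
      M) - 1 - int k)))"
  have "det ?A = (\<Sum>i<Suc M. ?A $$ (i, M) * cofactor ?A i M)"
    by (rule laplace_expansion_column) auto
  also have "\<dots> = 0"
  proof (rule sum.neutral, rule ballI)
    fix i assume i: "i \<in> {..<Suc M}"
    then have "row \<nu> i \<noteq> 0" using row_nonzero_iff[OF y] M by simp
    then have "(\<Prod>k<row \<nu> i + (Suc M - Suc i). w M - Const (c (int (Suc M) - 1 - int k))) = 0"
      by (intro prod_zero bexI[of _ 0]) (auto simp: w_def)
    then show "?A $$ (i, M) * cofactor ?A i M = 0" using i by simp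
  qed
  finally have "super_eval c w (Suc M) (multi_schur c \<nu>) * difference_prod w (Suc M) = 0"
    using super_eval_multi_schur[OF y, of "Suc M" c w] M by simp
  moreover have "difference_prod w (Suc M) \<noteq> 0"
  proof -
    have "w i - w j \<noteq> 0" if "i < j" "j < Suc M" for i j
    proof
      assume "w i - w j = 0"
      then have "Poly_Mapping.lookup (w i - w j) (Poly_Mapping.single i (Suc 0)) = 0" by simp
      moreover have "Poly_Mapping.lookup (w i) (Poly_Mapping.single i (Suc 0)) = 1"
        "Poly_Mapping.lookup (w j) (Poly_Mapping.single i (Suc 0)) = 0"
        using that by (simp_all add: w_def lookup_add lookup_Var_single lookup_Const_single)
      ultimately show False by (simp add: lookup_minus)
    qed
    moreover have "finite {(i, j). i < j \<and> j < Suc M}"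
      by (rule finite_subset[of _ "{..<Suc M} \<times> {..<Suc M}"]) auto
    ultimately show ?thesis by (auto simp: difference_prod_def)
  qed
  ultimately have "super_eval c w (Suc M) (multi_schur c \<nu>) = 0" by simp
  moreover have "super_eval c w (Suc M) f = super_eval c (shifted_Var c) M f" for f
    using super_eval_drop[of w M c f] super_eval_cong[of M w "shifted_Var c" c f]
        by (simp add: w_def)
  ultimately have "super_eval c (shifted_Var c) M (multi_schur c \<nu>) = 0" by simp
  then show ?thesis using super_eval_stable[OF M(2)] by simp
qed

lemma difference_prod_Var: "difference_prod Var N = vandermonde N"
  by (simp add: difference_prod_def vandermonde_def)

lemma vandermonde_nonzero: "vandermonde N \<noteq> (0 :: real mpoly)"
proof -
  have "Var i - Var j \<noteq> (0 :: real mpoly)" if "i < j" for i j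
  proof
    assume "Var i - Var j = (0 :: real mpoly)"
    then have "Poly_Mapping.lookup (Var i - Var j :: real mpoly) (Poly_Mapping.single i (Suc 0)) =
        0" by simp
    then show False using that by (simp add: lookup_minus lookup_Var_single)
  qed
  moreover have "finite {(i, j). i < j \<and> j < N}"
    by (rule finite_subset[of _ "{..<N} \<times> {..<N}"]) auto
  ultimately show ?thesis by (auto simp: vandermonde_def)
qed

lemma exact_quotient_vandermonde:
  "q * vandermonde N = (f :: real mpoly) \<Longrightarrow> exact_quotient f (vandermonde N) = q"
  unfolding exact_quotient_def by (rule the_equality) (use vandermonde_nonzero in auto)

text \<open>Schur functions are the multiparameter Schur functions for \<open>c = 0\<close>.\<close>

lemma specialize_eq_super_eval: "specialize N f = super_eval (\<lambda>_. 0) Var N f"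
  by (simp add: specialize_def super_eval_def)

theorem specialize_multi_schur:
  assumes "\<nu> \<in> young"
  shows "specialize N (multi_schur (\<lambda>_. 0) \<nu>) = schur_poly \<nu> N"
proof (cases "num_rows \<nu> \<le> N")
  case True
  then show ?thesis
    using super_eval_multi_schur[OF assms True, of "\<lambda>_. 0" Var]
    by (simp add: specialize_eq_super_eval schur_poly_def difference_prod_Var
        exact_quotient_vandermonde prod_constant)
next
  case False
  then show ?thesis
    using super_eval_multi_schur_eq_0[OF assms, of N "\<lambda>_. 0"]
        by (simp add: specialize_eq_super_eval schur_poly_def)
qed

theorem schur_eq:
  assumes "\<nu> \<in> young"
  shows "schur \<nu> = multi_schur (\<lambda>_. 0) \<nu>"
  unfolding schur_def
proof (rule the_equality)
  show "\<forall>N. specialize N (multi_schur (\<lambda>_. 0) \<nu>) = schur_poly \<nu> N"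
    using specialize_multi_schur[OF assms] by simp
  fix f assume f: "\<forall>N. specialize N f = schur_poly \<nu> N"
  have "super_eval (\<lambda>_. 0) Var N (f - multi_schur (\<lambda>_. 0) \<nu>) = 0" for N
    using f specialize_multi_schur[OF assms] by (simp add: specialize_eq_super_eval super_eval_def
        subst.hom_minus)
  then have "f - multi_schur (\<lambda>_. 0) \<nu> = 0" by (rule super_eval_eq_0_imp)
  then show "f = multi_schur (\<lambda>_. 0) \<nu>" by simp
qed

text \<open>
  The parameters of the Frobenius--Schur functions: the numbers \<open>-i + 1/2\<close> for \<open>i = j + 1\<close>,
  where \<open>j\<close> counts from \<open>0\<close>.
\<close>

definition half_points :: "int \<Rightarrow> real" where
  "half_points j = - (real_of_int j + 1) + 1 / 2"

lemma sym_to_star_eq_super_eval: "sym_to_star f N =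
    super_eval half_points (shifted_Var half_points) N f"
  by (simp add: sym_to_star_def super_eval_def power_sum_star_def half_points_def add.commute)

lemma inj_sym_to_star: "inj sym_to_star"
proof (rule injI)
  fix f g assume eq: "sym_to_star f = sym_to_star g"
  have "super_eval half_points Var N (f - g) = 0" for N
  proof -
    have "super_eval half_points (shifted_Var half_points) N (f - g) = 0"
      using fun_cong[OF eq, of N] unfolding sym_to_star_eq_super_eval
          by (simp add: super_eval_def subst.hom_minus)
    then have "subst (\<lambda>i. Var i - Const (half_points (int i)))
        (super_eval half_points (shifted_Var half_points) N (f - g)) = 0" by simp
    then show ?thesis by (simp add: super_eval_subst subst_add)
  qed
  then have "f - g = 0" by (rule super_eval_eq_0_imp)
  then show "f = g" by simp
qed

text \<open>
  The point \<open>w\<^sub>i\<close> in terms of the variable \<open>x\<^sub>i = y\<^sub>i + N - 1 - i\<close> of the factorial Schur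
  polynomials. Here \<open>w\<^sub>j - c\<^bsub>N-1-k\<^esub> = x\<^sub>j - k\<close>, so that the products in the alternant are
  falling factorials.
\<close>

abbreviation centered_Var :: "nat \<Rightarrow> nat \<Rightarrow> real mpoly" where
  "centered_Var N i \<equiv> Var i + Const (1 / 2 - real N)"

lemma shift_super_eval:
  "shift N (super_eval half_points (centered_Var N) N f) = sym_to_star f N"
  unfolding shift_def super_eval_subst sym_to_star_eq_super_eval
proof (rule super_eval_cong)
  fix i assume "i < N"
  have "of_nat (N - Suc i) + Const (1 / 2 - real N) =
      (Const (real (N - Suc i) + (1 / 2 - real N)) :: real mpoly)"
    by (simp only: Const_add Const.hom_of_nat)
  also have "real (N - Suc i) + (1 / 2 - real N) = half_points (int i)"
    using \<open>i < N\<close> by (simp add: half_points_def of_nat_diff)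
  finally show "subst (\<lambda>i. Var i + of_nat (N - Suc i)) (centered_Var N i) =
      shifted_Var half_points i"
    by (simp add: subst_add add.assoc)
qed

lemma shifted_schur_eq:
  assumes y: "\<nu> \<in> young"
  shows "shifted_schur \<nu> = sym_to_star (multi_schur half_points \<nu>)"
proof
  fix N
  show "shifted_schur \<nu> N = sym_to_star (multi_schur half_points \<nu>) N"
  proof (cases "num_rows \<nu> \<le> N")
    case True
    have V: "difference_prod (centered_Var N) N = vandermonde N"
      by (simp add: difference_prod_def vandermonde_def)
    have diff: "centered_Var N j - Const (half_points (int N - 1 - int k)) =
        Var j - of_nat k" for j k
    proof -
      have "Const (1 / 2 - real N) - Const (half_points (int N - 1 - int k)) =
        (Const (1 / 2 - real N - half_points (int N - 1 - int k)) :: real mpoly)"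
        by (simp add: Const.hom_minus)
      also have "1 / 2 - real N - half_points (int N - 1 - int k) = - real k"
        by (simp add: half_points_def)
      finally show ?thesis by (simp add: Const.hom_uminus Const.hom_of_nat algebra_simps)
    qed
    have "super_eval half_points (centered_Var N) N (multi_schur half_points \<nu>) * vandermonde N =
      det (mat N N (\<lambda>(i, j). falling (Var j) (row \<nu> i + (N - Suc i))))"
      using super_eval_multi_schur[OF y True, of half_points "centered_Var N"]
      unfolding V falling_def diff by simp
    then have "factorial_schur_poly \<nu> N = super_eval half_points (centered_Var N) N (multi_schur
        half_points \<nu>)"
      using True by (simp add: factorial_schur_poly_def exact_quotient_vandermonde)
    then show ?thesis by (simp add: shifted_schur_def shift_super_eval)
  next
    case False
    then show ?thesis
      using super_eval_multi_schur_eq_0[OF y, of N half_points]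
      by (simp add: shifted_schur_def factorial_schur_poly_def shift_def sym_to_star_eq_super_eval)
  qed
qed


lemma in_vars_add: "in_vars N f \<Longrightarrow> in_vars N g \<Longrightarrow> in_vars N (f + g)"
  unfolding in_vars_def using keys_add[of f g] by blast

lemma in_vars_diff: "in_vars N f \<Longrightarrow> in_vars N g \<Longrightarrow> in_vars N (f - g :: 'a::comm_ring_1 mpoly)"
  unfolding in_vars_def using keys_diff_mpoly[of f g] by blast

lemma in_vars_Const [simp]: "in_vars N (Const c)"
  by (auto simp: in_vars_def Const_def split: if_splits)

lemma in_vars_1 [simp]: "in_vars N 1"
  by (simp add: in_vars_def)

lemma in_vars_Var: "i < N \<Longrightarrow> in_vars N (Var i :: 'a::comm_ring_1 mpoly)"
  by (simp add: in_vars_def Var_def)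

lemma in_vars_mult:
  assumes "in_vars N f" "in_vars N g" shows "in_vars N (f * g :: 'a::comm_ring_1 mpoly)"
  unfolding in_vars_def
proof
  fix m assume "m \<in> Poly_Mapping.keys (f * g)"
  then obtain a b where ab: "m = a + b" "a \<in> Poly_Mapping.keys f" "b \<in> Poly_Mapping.keys g"
    using keys_mult[of f g] by blast
  then show "Poly_Mapping.keys m \<subseteq> {..<N}"
    using assms keys_add[of a b] unfolding in_vars_def by blast
qed

lemma in_vars_sum: "(\<And>x. x \<in> A \<Longrightarrow> in_vars N (f x)) \<Longrightarrow> in_vars N (sum f A)"
  by (induction A rule: infinite_finite_induct) (simp_all add: in_vars_add, simp_all add:
      in_vars_def)

lemma in_vars_power: "in_vars N f \<Longrightarrow> in_vars N (f ^ n :: 'a::comm_ring_1 mpoly)"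
  by (induction n) (simp_all add: in_vars_mult)

lemma in_vars_prod: "(\<And>x. x \<in> A \<Longrightarrow> in_vars N (f x)) \<Longrightarrow> in_vars N (prod f A :: 'a::comm_ring_1 mpoly)"
  by (induction A rule: infinite_finite_induct) (simp_all add: in_vars_mult)

lemma in_vars_subst: "(\<And>k. in_vars N (s k)) \<Longrightarrow> in_vars N (subst s f)"
  unfolding subst_def
  by (intro in_vars_sum in_vars_mult in_vars_prod in_vars_power) auto

lemma symmetric_super_eval:
  fixes a :: real
  assumes w: "\<And>i. w i = Var i + Const a"
  shows "symmetric_poly N (super_eval c w N f)"
  unfolding symmetric_poly_def
proof (intro conjI allI impI)
  show "in_vars N (super_eval c w N f)"
    unfolding super_eval_def w
    by (intro in_vars_subst in_vars_sum in_vars_diff in_vars_power in_vars_add in_vars_Var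
        in_vars_Const) auto
  fix \<pi> assume \<pi>: "\<pi> permutes {..<N}"
  have "subst (\<lambda>i. Var (\<pi> i)) (super_eval c w N f) = super_eval c (\<lambda>i. w (\<pi> i)) N f"
    by (simp add: super_eval_subst w subst_add)
  also have "\<dots> = super_eval c w N f"
  proof -
    have "(\<Sum>i<N. w (\<pi> i) ^ Suc k) = (\<Sum>i<N. w i ^ Suc k)" for k
      using sum.permute[OF \<pi>, of "\<lambda>i. w i ^ Suc k"] by (simp add: o_def)
    then show ?thesis by (simp only: super_eval_def sum_subtractf)
  qed
  finally show "subst (\<lambda>i. Var (\<pi> i)) (super_eval c w N f) = super_eval c w N f" .
qed

text \<open>The total degree is at most \<open>d\<close>.\<close>

definition degree_le :: "nat \<Rightarrow> 'a::zero mpoly \<Rightarrow> bool" where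
  "degree_le d f \<longleftrightarrow> (\<forall>m\<in>Poly_Mapping.keys f. mdegree m \<le> d)"

lemma mdegree_extend:
  assumes "finite K" "Poly_Mapping.keys m \<subseteq> K"
  shows "mdegree m = (\<Sum>k\<in>K. Poly_Mapping.lookup m k)"
  unfolding mdegree_def using assms
  by (intro sum.mono_neutral_left) (auto simp: in_keys_iff)

lemma mdegree_add: "mdegree (m + m') = mdegree m + mdegree m'"
proof -
  let ?K = "Poly_Mapping.keys m \<union> Poly_Mapping.keys m'"
  have "Poly_Mapping.keys (m + m') \<subseteq> ?K" by (rule keys_add)
  then have "mdegree (m + m') = (\<Sum>k\<in>?K. Poly_Mapping.lookup (m + m') k)"
    by (intro mdegree_extend) auto
  also have "\<dots> = (\<Sum>k\<in>?K. Poly_Mapping.lookup m k) + (\<Sum>k\<in>?K. Poly_Mapping.lookup m' k)"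
    by (simp add: lookup_add sum.distrib)
  also have "\<dots> = mdegree m + mdegree m'"
    by (simp add: mdegree_extend[of ?K])
  finally show ?thesis .
qed

lemma degree_le_0 [simp]: "degree_le d 0"
  by (simp add: degree_le_def)

lemma degree_le_mono: "degree_le d f \<Longrightarrow> d \<le> e \<Longrightarrow> degree_le e f"
  by (force simp: degree_le_def)

lemma degree_le_Const [simp]: "degree_le d (Const c)"
  by (auto simp: degree_le_def Const_def mdegree_def split: if_splits)

lemma degree_le_1 [simp]: "degree_le d 1"
  by (simp add: degree_le_def mdegree_def)

lemma degree_le_Var: "degree_le 1 (Var i :: 'a::comm_ring_1 mpoly)"
  by (simp add: degree_le_def Var_def mdegree_def)

lemma degree_le_add: "degree_le d f \<Longrightarrow> degree_le d g \<Longrightarrow> degree_le d (f + g)"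
  unfolding degree_le_def using keys_add[of f g] by blast

lemma degree_le_diff: "degree_le d f \<Longrightarrow> degree_le d g \<Longrightarrow> degree_le d (f - g :: 'a::comm_ring_1 mpoly)"
  unfolding degree_le_def using keys_diff_mpoly[of f g] by blast

lemma degree_le_sum: "(\<And>x. x \<in> A \<Longrightarrow> degree_le d (f x)) \<Longrightarrow> degree_le d (sum f A)"
  by (induction A rule: infinite_finite_induct) (auto simp: degree_le_add)

lemma degree_le_mult:
  assumes "degree_le d f" "degree_le e g" shows "degree_le (d + e) (f * g :: 'a::comm_ring_1 mpoly)"
  unfolding degree_le_def
proof
  fix m assume "m \<in> Poly_Mapping.keys (f * g)"
  then obtain a b where "m = a + b" "a \<in> Poly_Mapping.keys f" "b \<in> Poly_Mapping.keys g"
    using keys_mult[of f g] by blast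
  then show "mdegree m \<le> d + e" using assms by (auto simp: degree_le_def mdegree_add intro:
      add_mono)
qed

lemma degree_le_power: "degree_le d f \<Longrightarrow> degree_le (d * n) (f ^ n :: 'a::comm_ring_1 mpoly)"
  by (induction n) (auto dest: degree_le_mult)

lemma degree_le_prod:
  assumes "\<And>x. x \<in> A \<Longrightarrow> degree_le (d x) (f x :: 'a::comm_ring_1 mpoly)"
  shows "degree_le (sum d A) (prod f A)"
  using assms by (induction A rule: infinite_finite_induct) (auto intro: degree_le_mult)

lemma degree_le_subst:
  assumes "\<And>k. degree_le (Suc k) (s k)" "f \<in> sym_upto n"
  shows "degree_le n (subst s f)"
  unfolding subst_def
proof (rule degree_le_sum)
  fix m assume m: "m \<in> Poly_Mapping.keys f"
  have "degree_le (weight m) (\<Prod>i\<in>Poly_Mapping.keys m. s i ^ Poly_Mapping.lookup m i)"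
    unfolding weight_def by (intro degree_le_prod degree_le_power assms(1))
  from degree_le_mult[OF degree_le_Const[of 0] this]
  have "degree_le (weight m) (Const (Poly_Mapping.lookup f m) * (\<Prod>i\<in>Poly_Mapping.keys m. s i ^
      Poly_Mapping.lookup m i))"
    by simp
  then show "degree_le n (Const (Poly_Mapping.lookup f m) * (\<Prod>i\<in>Poly_Mapping.keys m. s i ^
      Poly_Mapping.lookup m i))"
    by (rule degree_le_mono) (use assms(2) m in \<open>auto simp: sym_upto_def\<close>)
qed

theorem sym_to_star_in_sym_star: "sym_to_star f \<in> sym_star"
  unfolding sym_star_def
proof (intro CollectI conjI allI)
  fix N
  show "shifted_symmetric_poly N (sym_to_star f N)"
    unfolding shifted_symmetric_poly_def
    using symmetric_super_eval[of "centered_Var N"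
        "1 / 2 - real N" N half_points f] shift_super_eval[of N f]
    by (metis (no_types, lifting))
  show "subst (\<lambda>i. if i = N then 0 else Var i) (sym_to_star f (Suc N)) = sym_to_star f N"
  proof -
    let ?t = "\<lambda>i. if i = N then 0 else Var i"
    have "subst ?t (sym_to_star f (Suc N)) =
      super_eval half_points (\<lambda>i. subst ?t (shifted_Var half_points i)) (Suc N) f"
      unfolding sym_to_star_eq_super_eval super_eval_subst ..
    also have "\<dots> = super_eval half_points (\<lambda>i. subst ?t (shifted_Var half_points i)) N f"
      by (rule super_eval_drop) (simp add: subst_add)
    also have "\<dots> = sym_to_star f N"
      unfolding sym_to_star_eq_super_eval by (rule super_eval_cong) (simp add: subst_add)
    finally show ?thesis .
  qed
next
  obtain n where n: "f \<in> sym_upto n" using sym_upto_exists by blast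
  have "degree_le n (sym_to_star f N)" for N
    unfolding sym_to_star_eq_super_eval super_eval_def
  proof (rule degree_le_subst[OF _ n], intro degree_le_sum degree_le_diff degree_le_Const)
    fix k i
    have "degree_le 1 (shifted_Var half_points i)"
      by (intro degree_le_add degree_le_Var degree_le_Const)
    from degree_le_power[OF this, of "Suc k"] show
        "degree_le (Suc k) (shifted_Var half_points i ^ Suc k)"
      by (simp only: mult_1_left)
  qed
  then show "\<exists>d. \<forall>N. \<forall>m\<in>Poly_Mapping.keys (sym_to_star f N). mdegree m \<le> d"
    unfolding degree_le_def by blast
qed

theorem frobenius_schur_eq:
  assumes "\<nu> \<in> young"
  shows "frobenius_schur \<nu> = multi_schur half_points \<nu>"
  unfolding frobenius_schur_def star_to_sym_def shifted_schur_eq[OF assms]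
  using sym_to_star_in_sym_star inj_sym_to_star by (simp add: inv_into_f_f)


section \<open>The Laguerre and Meixner operators\<close>

lemma lookup_complexify [simp]: "Poly_Mapping.lookup (complexify f) m =
    complex_of_real (Poly_Mapping.lookup f m)"
  by (simp add: complexify_def Poly_Mapping.map.rep_eq when_def)

lemma lookup_scale [simp]: "Poly_Mapping.lookup (scale c f) m = c * Poly_Mapping.lookup f m"
  by (simp add: scale_def Poly_Mapping.map.rep_eq when_def)

lemma lookup_pow_G [simp]:
  "Poly_Mapping.lookup (pow_G \<epsilon> s f) m = \<epsilon> powi (s * int (weight m)) * Poly_Mapping.lookup f m"
  by (simp add: pow_G_def lookup_mapp when_def in_keys_iff)

interpretation complex_sym: vector_space scale
  by unfold_locales (auto intro!: poly_mapping_eqI simp: lookup_add algebra_simps)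

interpretation complex_sym: vector_space_pair scale scale ..

lemma complexify_add: "complexify (f + g) = complexify f + complexify g"
  by (rule poly_mapping_eqI) (simp add: lookup_add)

lemma complexify_Const_mult: "complexify (Const r * f) = scale (complex_of_real r) (complexify f)"
  by (rule poly_mapping_eqI) (simp add: lookup_Const_mult)

lemma complexify_0 [simp]: "complexify 0 = 0"
  by (rule poly_mapping_eqI) simp

lemma inj_complexify: "inj complexify"
proof (rule injI, rule poly_mapping_eqI)
  fix f g m assume "complexify f = complexify g"
  then have "Poly_Mapping.lookup (complexify f) m = Poly_Mapping.lookup (complexify g) m" by simp
  then show "Poly_Mapping.lookup f m = Poly_Mapping.lookup g m" by simp
qed

lemma complexify_in_sym_upto: "f \<in> sym_upto n \<Longrightarrow> complexify f \<in> sym_upto n"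
  by (auto simp: sym_upto_def in_keys_iff)

lemma complexify_span:
  assumes "f \<in> real_sym.span B" shows "complexify f \<in> complex_sym.span (complexify ` B)"
  using assms
proof (induction rule: real_sym.span_induct_alt)
  case base
  show ?case by (simp add: complex_sym.span_zero)
next
  case (step r g h)
  then show ?case
    by (simp add: complexify_add complexify_Const_mult complex_sym.span_add complex_sym.span_scale
        complex_sym.span_base)
qed

lemma subspace_sym_upto: "complex_sym.subspace (sym_upto n)"
  by (rule complex_sym.subspaceI)
     (simp_all add: sym_upto_iff_below below_add, auto simp: below_def in_keys_iff)

lemma complex_mpoly_sum_monomials:
  "f = (\<Sum>m\<in>Poly_Mapping.keys f. scale (Poly_Mapping.lookup f m) (Poly_Mapping.single m 1))"
  by (rule poly_mapping_eqI) (auto simp: lookup_sum lookup_single when_def in_keys_iff if_distrib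
      cong: if_cong)

lemma complex_sym_upto_in_span_monomials: "sym_upto n \<subseteq> complex_sym.span (monomials_upto n)"
proof
  fix f :: "complex sym" assume "f \<in> sym_upto n"
  then show "f \<in> complex_sym.span (monomials_upto n)"
    by (subst complex_mpoly_sum_monomials, intro complex_sym.span_sum complex_sym.span_scale
        complex_sym.span_base)
       (auto simp: sym_upto_def)
qed

lemma independent_monomials: "complex_sym.independent (monomials_upto n)"
proof -
  let ?e = "\<lambda>m. Poly_Mapping.single m (1 :: complex)"
  have inj: "inj_on ?e M" for M :: "mono set"
    by (intro inj_onI) (drule arg_cong[of _ _ Poly_Mapping.keys], simp)
  have "\<forall>f\<in>monomials_upto n. u f = 0" if 0: "(\<Sum>f\<in>monomials_upto n. scale (u f) f) = 0" for u
  proof safe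
    fix m assume m: "weight m \<le> n"
    have "(\<Sum>m\<in>{m. weight m \<le> n}. scale (u (?e m)) (?e m)) = 0"
      using 0 by (simp add: sum.reindex[OF inj])
    then have "Poly_Mapping.lookup (\<Sum>m\<in>{m. weight m \<le> n}. scale (u (?e m)) (?e m)) m = 0" by simp
    then show "u (?e m) = 0"
      using m card_mono_le_card_young[of n]
      by (simp add: lookup_sum lookup_single when_def if_distrib cong: if_cong)
  qed
  then show ?thesis
    by (subst complex_sym.dependent_finite) (use finite_monomials_upto in blast)+
qed

text \<open>Multiparameter Schur functions as elements of the complexified algebra.\<close>

definition multi_schur_c :: "(int \<Rightarrow> real) \<Rightarrow> (nat \<times> nat) set \<Rightarrow> complex sym" where
  "multi_schur_c c \<nu> = complexify (multi_schur c \<nu>)"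

lemma monomials_in_span_multi_schur_c:
  "monomials_upto n \<subseteq> complex_sym.span (multi_schur_c c ` young_upto n)"
proof
  fix f :: "complex sym" assume "f \<in> monomials_upto n"
  then obtain m where m: "weight m \<le> n" "f = Poly_Mapping.single m 1" by auto
  then have f: "f = complexify (Poly_Mapping.single m 1)"
    by (intro poly_mapping_eqI) (simp add: lookup_single when_def)
  have "Poly_Mapping.single m 1 \<in> real_sym.span (multi_schur c ` young_upto n)"
    using sym_upto_span_multi_schur[of n c] m by (auto simp: sym_upto_def)
  from complexify_span[OF this] show "f \<in> complex_sym.span (multi_schur_c c ` young_upto n)"
    by (simp add: f image_image multi_schur_c_def)
qed

theorem sym_upto_span_multi_schur_c: "sym_upto n \<subseteq> complex_sym.span (multi_schur_c c ` young_upto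
    n)"
  using complex_sym_upto_in_span_monomials[of n]
    complex_sym.span_minimal[OF monomials_in_span_multi_schur_c complex_sym.subspace_span, of n c]
        by blast

text \<open>
  The spanning property passes from real to complex scalars at once; independence over the
  complex numbers is then a matter of cardinality.
\<close>

lemma independent_multi_schur_c_upto: "complex_sym.independent (multi_schur_c c ` young_upto n)"
  by (rule complex_sym.spanning_imp_independent_by_card[OF independent_monomials
      monomials_in_span_multi_schur_c])
     (simp_all add: finite_young_upto card_monomials_upto card_young_eq_card_mono[symmetric]
         card_image_le)

lemma young_eq_Union: "young = (\<Union>n. young_upto n)"
  by (auto simp: young_upto_def)

lemma independent_multi_schur_c: "complex_sym.independent (multi_schur_c c ` young)"
proof -
  have "complex_sym.independent (\<Union>(range (\<lambda>n. multi_schur_c c ` young_upto n)))"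
  proof (rule complex_sym.independent_Union_directed)
    fix A B assume "A \<in> range (\<lambda>n. multi_schur_c c ` young_upto n)"
        "B \<in> range (\<lambda>n. multi_schur_c c ` young_upto n)"
    then obtain m n where "A = multi_schur_c c ` young_upto m" "B =
        multi_schur_c c ` young_upto n" by blast
    moreover have "young_upto m \<subseteq> young_upto n \<or> young_upto n \<subseteq> young_upto m"
      by (cases "m \<le> n") (auto simp: young_upto_def)
    ultimately show "A \<subseteq> B \<or> B \<subseteq> A" by (metis image_mono)
  qed (use independent_multi_schur_c_upto in auto)
  then show ?thesis by (simp add: young_eq_Union image_UN)
qed

lemma span_multi_schur_c: "f \<in> complex_sym.span (multi_schur_c c ` young)"
proof -
  obtain n where "f \<in> sym_upto n" using sym_upto_exists by blast
  then have "f \<in> complex_sym.span (multi_schur_c c ` young_upto n)" using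
      sym_upto_span_multi_schur_c by blast
  then show ?thesis
    by (rule subsetD[OF complex_sym.span_mono, rotated]) (auto simp: young_upto_def)
qed

lemma inj_on_multi_schur_c: "inj_on (multi_schur_c c) young"
proof (rule inj_onI)
  fix \<nu> \<mu> assume *: "\<nu> \<in> young" "\<mu> \<in> young" "multi_schur_c c \<nu> = multi_schur_c c \<mu>"
  then have "multi_schur c \<nu> = multi_schur c \<mu>"
    using inj_complexify by (auto simp: multi_schur_c_def dest: injD)
  moreover have "\<nu> \<in> young_upto (card \<nu> + card \<mu>)" "\<mu> \<in> young_upto (card \<nu> + card \<mu>)"
    using * by (auto simp: young_upto_def)
  ultimately show "\<nu> = \<mu>" using inj_on_multi_schur by (meson inj_onD)
qed

text \<open>
  Exactly one linear operator takes prescribed values at the multiparameter Schur functions for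
  given parameters.
\<close>

lemma ex1_operator:
  "\<exists>!D. Vector_Spaces.linear scale scale D \<and> (\<forall>\<nu>\<in>young. D (multi_schur_c c \<nu>) = T \<nu>)"
proof -
  obtain D where D: "Vector_Spaces.linear scale scale D"
    "\<forall>f\<in>multi_schur_c c ` young. D f = T (the_inv_into young (multi_schur_c c) f)"
    using complex_sym.linear_independent_extend[OF independent_multi_schur_c[of c],
        where f = "\<lambda>f. T (the_inv_into young (multi_schur_c c) f)"] by blast
  show ?thesis
  proof (rule ex1I[of _ D])
    show "Vector_Spaces.linear scale scale D \<and> (\<forall>\<nu>\<in>young. D (multi_schur_c c \<nu>) = T \<nu>)"
      using D by (simp add: the_inv_into_f_f[OF inj_on_multi_schur_c])
    fix E assume E: "Vector_Spaces.linear scale scale E \<and> (\<forall>\<nu>\<in>young. E (multi_schur_c c \<nu>) = T \<nu>)"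
    show "E = D"
    proof
      fix f show "E f = D f"
        by (rule complex_sym.linear_eq_on_span[where B = "multi_schur_c c ` young"])
           (use D E span_multi_schur_c in \<open>auto simp: the_inv_into_f_f[OF inj_on_multi_schur_c]\<close>)
    qed
  qed
qed

lemma multi_schur_c_in_sym_upto: "\<nu> \<in> young_upto n \<Longrightarrow> multi_schur_c c \<nu> \<in> sym_upto n"
  unfolding multi_schur_c_def by (intro complexify_in_sym_upto multi_schur_in_sym_upto)

lemma corners_young_upto:
  assumes "\<nu> \<in> young_upto n" "b \<in> corners \<nu>"
  shows "\<nu> - {b} \<in> young_upto n"
  using corners_young[of \<nu> b] assms by (auto simp: young_upto_def)

lemma operator_preserves_sym_upto:
  assumes D: "Vector_Spaces.linear scale scale D"
    and "\<And>\<nu>. \<nu> \<in> young_upto n \<Longrightarrow> D (multi_schur_c c \<nu>) \<in> sym_upto n" and f: "f \<in> sym_upto n"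
  shows "D f \<in> sym_upto n"
proof -
  have "f \<in> complex_sym.span (multi_schur_c c ` young_upto n)"
    using f sym_upto_span_multi_schur_c by blast
  moreover have "complex_sym.subspace {f. D f \<in> sym_upto n}"
    using complex_sym.linear_subspace_vimage[OF D subspace_sym_upto] by (simp add: vimage_def)
  ultimately show ?thesis
    by (rule complex_sym.span_induct) (use assms(2) in auto)
qed

text \<open>
  The common right-hand side of the definitions of both operators, with \<open>t = 1\<close> in the Laguerre
  case and \<open>t = \<xi> / (1 - \<xi>)\<close> in the Meixner case.
\<close>

definition lowering :: "complex \<Rightarrow> complex \<Rightarrow> complex \<Rightarrow> (int \<Rightarrow> real) \<Rightarrow> (nat \<times> nat) set \<Rightarrow> complex
    sym" where
  "lowering z z' t c \<nu> = scale (- of_nat (card \<nu>)) (multi_schur_c c \<nu>) + scale t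
     (\<Sum>b\<in>corners \<nu>. scale ((z + of_int (content b)) * (z' + of_int (content b))) (multi_schur_c c
         (\<nu> - {b})))"

lemma lowering_in_sym_upto: "\<nu> \<in> young_upto n \<Longrightarrow> lowering z z' t c \<nu> \<in> sym_upto n"
  unfolding lowering_def
  by (intro complex_sym.subspace_add[OF subspace_sym_upto] complex_sym.subspace_scale[OF
      subspace_sym_upto]
      complex_sym.subspace_sum[OF subspace_sym_upto] multi_schur_c_in_sym_upto corners_young_upto)

lemma laguerre_op_props:
  shows "Vector_Spaces.linear scale scale (laguerre_op z z')"
    and "\<nu> \<in> young \<Longrightarrow> laguerre_op z z' (multi_schur_c (\<lambda>_. 0) \<nu>) = lowering z z' 1 (\<lambda>_. 0) \<nu>"
proof -
  have "laguerre_op z z' = (THE D. Vector_Spaces.linear scale scale D \<and>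
     (\<forall>\<nu>\<in>young. D (multi_schur_c (\<lambda>_. 0) \<nu>) = lowering z z' 1 (\<lambda>_. 0) \<nu>))"
    unfolding laguerre_op_def lowering_def
    by (intro arg_cong[of _ _ The] ext conj_cong ball_cong refl arg_cong2[of _ _ _ _ "(=)"])
       (auto simp: multi_schur_c_def schur_eq corners_young intro!: sum.cong)
  then show "Vector_Spaces.linear scale scale (laguerre_op z z')"
    and "\<nu> \<in> young \<Longrightarrow> laguerre_op z z' (multi_schur_c (\<lambda>_. 0) \<nu>) = lowering z z' 1 (\<lambda>_. 0) \<nu>"
    using theI'[OF ex1_operator[of "\<lambda>_. 0" "lowering z z' 1 (\<lambda>_. 0)"]] by simp_all
qed

lemma meixner_op_props:
  shows "Vector_Spaces.linear scale scale (meixner_op z z' \<xi>)"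
    and "\<nu> \<in> young \<Longrightarrow> meixner_op z z' \<xi> (multi_schur_c half_points \<nu>) =
        lowering z z' (\<xi> / (1 - \<xi>)) half_points \<nu>"
proof -
  have "meixner_op z z' \<xi> = (THE D. Vector_Spaces.linear scale scale D \<and>
     (\<forall>\<nu>\<in>young. D (multi_schur_c half_points \<nu>) = lowering z z' (\<xi> / (1 - \<xi>)) half_points \<nu>))"
    unfolding meixner_op_def lowering_def
    by (intro arg_cong[of _ _ The] ext conj_cong ball_cong refl arg_cong2[of _ _ _ _ "(=)"])
       (auto simp: multi_schur_c_def frobenius_schur_eq corners_young intro!: sum.cong arg_cong[of
           _ _ "scale _"])
  then show "Vector_Spaces.linear scale scale (meixner_op z z' \<xi>)"
    and "\<nu> \<in> young \<Longrightarrow> meixner_op z z' \<xi> (multi_schur_c half_points \<nu>) =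
        lowering z z' (\<xi> / (1 - \<xi>)) half_points \<nu>"
    using theI'[OF ex1_operator[of half_points "lowering z z' (\<xi> / (1 - \<xi>)) half_points"]]
        by simp_all
qed


section \<open>The limit\<close>

lemma pow_G_linear: "Vector_Spaces.linear scale scale (pow_G \<epsilon> s)"
  by (intro Vector_Spaces.linear.intro module_hom.intro module_hom_axioms.intro
      complex_sym.vector_space_axioms complex_sym.module_axioms)
     (auto intro!: poly_mapping_eqI simp: lookup_add algebra_simps)

lemma pow_G_in_sym_upto: "f \<in> sym_upto n \<Longrightarrow> pow_G \<epsilon> s f \<in> sym_upto n"
  by (auto simp: sym_upto_def in_keys_iff)

lemma pow_G_inverse: "\<epsilon> \<noteq> 0 \<Longrightarrow> pow_G \<epsilon> 1 (pow_G \<epsilon> (-1) f) = f"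
  by (rule poly_mapping_eqI) (simp add: power_int_minus)

lemma laguerre_in_sym_upto: "f \<in> sym_upto n \<Longrightarrow> laguerre_op z z' f \<in> sym_upto n"
  by (rule operator_preserves_sym_upto[OF laguerre_op_props(1), where c = "\<lambda>_. 0"])
     (auto simp: laguerre_op_props(2) lowering_in_sym_upto young_upto_def)

lemma meixner_in_sym_upto: "f \<in> sym_upto n \<Longrightarrow> meixner_op z z' \<xi> f \<in> sym_upto n"
  by (rule operator_preserves_sym_upto[OF meixner_op_props(1), where c = half_points])
     (auto simp: meixner_op_props(2) lowering_in_sym_upto young_upto_def)

lemma meixner_eps_linear: "Vector_Spaces.linear scale scale (meixner_eps z z' \<epsilon>)"
  unfolding meixner_eps_def
  by (rule Vector_Spaces.linear_compose[OF pow_G_linear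
        Vector_Spaces.linear_compose[OF meixner_op_props(1) pow_G_linear], unfolded
            comp_assoc[symmetric]])

lemma meixner_eps_in_sym_upto: "f \<in> sym_upto n \<Longrightarrow> meixner_eps z z' \<epsilon> f \<in> sym_upto n"
  by (simp add: meixner_eps_def pow_G_in_sym_upto meixner_in_sym_upto)

text \<open>
  Convergence of each coefficient as \<open>\<epsilon> \<rightarrow> 0\<close>. On a space of bounded degree only finitely many
  coefficients matter, and this becomes convergence of operators (\<open>op_tendsto_on_sym_uptoI\<close>).
\<close>

definition coeff_tendsto :: "(complex \<Rightarrow> complex sym) \<Rightarrow> complex sym \<Rightarrow> bool" where
  "coeff_tendsto F g \<longleftrightarrow> (\<forall>m. ((\<lambda>\<epsilon>. Poly_Mapping.lookup (F \<epsilon>) m) \<longlongrightarrow> Poly_Mapping.lookup g m) (at 0))"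

lemma coeff_tendsto_add:
  "coeff_tendsto F f \<Longrightarrow> coeff_tendsto G g \<Longrightarrow> coeff_tendsto (\<lambda>\<epsilon>. F \<epsilon> + G \<epsilon>) (f + g)"
  by (auto simp: coeff_tendsto_def lookup_add intro!: tendsto_add)

lemma coeff_tendsto_diff:
  "coeff_tendsto F f \<Longrightarrow> coeff_tendsto G g \<Longrightarrow> coeff_tendsto (\<lambda>\<epsilon>. F \<epsilon> - G \<epsilon>) (f - g)"
  by (auto simp: coeff_tendsto_def lookup_minus intro!: tendsto_diff)

lemma coeff_tendsto_scale:
  "(a \<longlongrightarrow> b) (at 0) \<Longrightarrow> coeff_tendsto F f \<Longrightarrow> coeff_tendsto (\<lambda>\<epsilon>. scale (a \<epsilon>) (F \<epsilon>)) (scale b f)"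
  by (auto simp: coeff_tendsto_def intro!: tendsto_mult)

lemma coeff_tendsto_sum:
  "(\<And>x. x \<in> A \<Longrightarrow> coeff_tendsto (F x) (f x)) \<Longrightarrow> coeff_tendsto (\<lambda>\<epsilon>. \<Sum>x\<in>A. F x \<epsilon>) (\<Sum>x\<in>A. f x)"
  by (auto simp: coeff_tendsto_def lookup_sum intro!: tendsto_sum)

lemma coeff_tendsto_cong:
  assumes "\<And>\<epsilon>. \<epsilon> \<noteq> 0 \<Longrightarrow> F \<epsilon> = G \<epsilon>" "coeff_tendsto G g"
  shows "coeff_tendsto F g"
  unfolding coeff_tendsto_def
proof
  fix m
  have "\<forall>\<^sub>F \<epsilon> in at 0. Poly_Mapping.lookup (G \<epsilon>) m = Poly_Mapping.lookup (F \<epsilon>) m"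
    using assms(1) by (auto simp: eventually_at_filter)
  then show "((\<lambda>\<epsilon>. Poly_Mapping.lookup (F \<epsilon>) m) \<longlongrightarrow> Poly_Mapping.lookup g m) (at 0)"
    by (rule Lim_transform_eventually[rotated]) (use assms(2) in \<open>simp add: coeff_tendsto_def\<close>)
qed

text \<open>The element \<open>\<epsilon>\<^bsup>|\<nu>|\<^esup> \<epsilon>\<^bsup>-G\<^esup> FS\<^sub>\<nu>\<close>, which tends to \<open>S\<^sub>\<nu>\<close>.\<close>

definition rescaled_fs :: "complex \<Rightarrow> (nat \<times> nat) set \<Rightarrow> complex sym" where
  "rescaled_fs \<epsilon> \<nu> = scale (\<epsilon> ^ card \<nu>) (pow_G \<epsilon> (-1) (multi_schur_c half_points \<nu>))"

lemma lookup_multi_schur_c_eq: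
  assumes y: "\<nu> \<in> young" and m: "card \<nu> \<le> weight m"
  shows "Poly_Mapping.lookup (multi_schur_c half_points \<nu>) m =
      Poly_Mapping.lookup (multi_schur_c (\<lambda>_. 0) \<nu>) m"
proof -
  have "below (int (card \<nu>)) (multi_schur half_points \<nu> - multi_schur (\<lambda>_. 0) \<nu>)"
    using leading_part_multi_schur[OF y, of half_points] by (simp add: leading_part_def)
  then have "m \<notin> Poly_Mapping.keys (multi_schur half_points \<nu> - multi_schur (\<lambda>_. 0) \<nu>)"
    using m by (auto simp: below_def)
  then show ?thesis by (simp add: in_keys_iff lookup_minus multi_schur_c_def)
qed

lemma lookup_schur_eq_0:
  assumes y: "\<nu> \<in> young" and m: "weight m \<noteq> card \<nu>"
  shows "Poly_Mapping.lookup (multi_schur_c (\<lambda>_. 0) \<nu>) m = 0"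
proof -
  have "graded (int (card \<nu>)) (multi_schur (\<lambda>_. 0) \<nu>)"
    using leading_part_multi_schur[OF y, of half_points] by (simp add: leading_part_def)
  then have "m \<notin> Poly_Mapping.keys (multi_schur (\<lambda>_. 0) \<nu>)"
    using m by (auto simp: graded_def)
  then show ?thesis by (simp add: in_keys_iff multi_schur_c_def)
qed

lemma rescaled_fs_expansion:
  assumes y: "\<nu> \<in> young" and \<epsilon>: "\<epsilon> \<noteq> 0"
  shows "rescaled_fs \<epsilon> \<nu> = multi_schur_c (\<lambda>_. 0) \<nu> + (\<Sum>m | weight m < card \<nu>.
    scale (\<epsilon> ^ (card \<nu> - weight m) * Poly_Mapping.lookup (multi_schur_c half_points \<nu>) m)
        (Poly_Mapping.single m 1))"
proof (rule poly_mapping_eqI)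
  fix m
  let ?a = "Poly_Mapping.lookup (multi_schur_c half_points \<nu>)"
  have "finite {m. weight m < card \<nu>}"
    using card_mono_le_card_young[of "card \<nu>"] by (auto intro: finite_subset[rotated])
  then have R: "Poly_Mapping.lookup (\<Sum>m | weight m < card \<nu>. scale (\<epsilon> ^ (card \<nu> - weight m) * ?a
      m) (Poly_Mapping.single m 1)) m =
      (if weight m < card \<nu> then \<epsilon> ^ (card \<nu> - weight m) * ?a m else 0)"
    by (simp add: lookup_sum lookup_single when_def if_distrib cong: if_cong)
  have "?a m = 0" if "weight m > card \<nu>"
    using lookup_multi_schur_c_eq[OF y, of m] lookup_schur_eq_0[OF y, of m] that by simp
  moreover have "\<epsilon> ^ card \<nu> * (\<epsilon> powi (- int (weight m)) * ?a m) = \<epsilon> ^ (card \<nu> - weight m) * ?a m"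
      if "weight m \<le> card \<nu>"
    using \<epsilon> that by (simp add: power_int_minus power_diff field_simps)
  moreover have "Poly_Mapping.lookup (rescaled_fs \<epsilon> \<nu>) m =
      \<epsilon> ^ card \<nu> * (\<epsilon> powi (- int (weight m)) * ?a m)"
    by (simp add: rescaled_fs_def)
  ultimately have "Poly_Mapping.lookup (rescaled_fs \<epsilon> \<nu>) m =
      (if weight m \<le> card \<nu> then \<epsilon> ^ (card \<nu> - weight m) * ?a m else 0)"
    by simp
  also have "\<dots> = Poly_Mapping.lookup (multi_schur_c (\<lambda>_. 0) \<nu>) m +
      (if weight m < card \<nu> then \<epsilon> ^ (card \<nu> - weight m) * ?a m else 0)"
  proof (cases "weight m = card \<nu>")
    case True
    then show ?thesis using lookup_multi_schur_c_eq[OF y, of m] by simp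
  next
    case False
    then show ?thesis using lookup_schur_eq_0[OF y False] by simp
  qed
  finally show "Poly_Mapping.lookup (rescaled_fs \<epsilon> \<nu>) m =
    Poly_Mapping.lookup (multi_schur_c (\<lambda>_. 0) \<nu> + (\<Sum>m | weight m < card \<nu>. scale (\<epsilon> ^ (card \<nu> -
        weight m) * ?a m) (Poly_Mapping.single m 1))) m"
    unfolding lookup_add R .
qed

lemma tendsto_power_diff_0: "k < n \<Longrightarrow> ((\<lambda>\<epsilon>::complex. \<epsilon> ^ (n - k) * a) \<longlongrightarrow> 0) (at 0)"
  by (rule tendsto_eq_intros | simp)+

lemma rescaled_fs_tendsto:
  assumes y: "\<nu> \<in> young"
  shows "coeff_tendsto (\<lambda>\<epsilon>. rescaled_fs \<epsilon> \<nu>) (multi_schur_c (\<lambda>_. 0) \<nu>)"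
proof (rule coeff_tendsto_cong[OF rescaled_fs_expansion[OF y]])
  let ?a = "Poly_Mapping.lookup (multi_schur_c half_points \<nu>)"
  have "coeff_tendsto (\<lambda>\<epsilon>. multi_schur_c (\<lambda>_. 0) \<nu> +
     (\<Sum>m | weight m < card \<nu>. scale (\<epsilon> ^ (card \<nu> - weight m) * ?a m) (Poly_Mapping.single m 1)))
    (multi_schur_c (\<lambda>_. 0) \<nu> + (\<Sum>m | weight m < card \<nu>. scale 0 (Poly_Mapping.single m 1)))"
    by (intro coeff_tendsto_add coeff_tendsto_sum coeff_tendsto_scale tendsto_power_diff_0)
       (auto simp: coeff_tendsto_def)
  then show "coeff_tendsto (\<lambda>\<epsilon>. multi_schur_c (\<lambda>_. 0) \<nu> +
     (\<Sum>m | weight m < card \<nu>. scale (\<epsilon> ^ (card \<nu> - weight m) * ?a m) (Poly_Mapping.single m 1)))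
    (multi_schur_c (\<lambda>_. 0) \<nu>)" by simp
qed

lemma meixner_eps_rescaled_fs:
  assumes y: "\<nu> \<in> young" and \<epsilon>: "\<epsilon> \<noteq> 0"
  shows "meixner_eps z z' \<epsilon> (rescaled_fs \<epsilon> \<nu>) = scale (- of_nat (card \<nu>)) (rescaled_fs \<epsilon> \<nu>) +
    scale (1 - \<epsilon>) (\<Sum>b\<in>corners \<nu>. scale ((z + of_int (content b)) * (z' + of_int (content b)))
        (rescaled_fs \<epsilon> (\<nu> - {b})))"
proof -
  interpret A: Vector_Spaces.linear scale scale "meixner_eps z z' \<epsilon>" by (rule meixner_eps_linear)
  interpret P: Vector_Spaces.linear scale scale "pow_G \<epsilon> (-1)" by (rule pow_G_linear)
  let ?w = "\<lambda>b. (z + of_int (content b)) * (z' + of_int (content b))"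
  let ?G = "\<lambda>\<nu>. pow_G \<epsilon> (-1) (multi_schur_c half_points \<nu>)"
  have "meixner_eps z z' \<epsilon> (rescaled_fs \<epsilon> \<nu>) =
     scale (\<epsilon> ^ card \<nu>) (pow_G \<epsilon> (-1) (meixner_op z z' (1 - \<epsilon>) (multi_schur_c half_points \<nu>)))"
    unfolding rescaled_fs_def A.scale by (simp add: meixner_eps_def pow_G_inverse[OF \<epsilon>])
  also have "\<dots> = scale (\<epsilon> ^ card \<nu>) (scale (- of_nat (card \<nu>)) (?G \<nu>) + scale ((1 - \<epsilon>) / \<epsilon>)
      (\<Sum>b\<in>corners \<nu>. scale (?w b) (?G (\<nu> - {b}))))"
  proof -
    have "1 - (1 - \<epsilon>) = \<epsilon>" by simp
    then show ?thesis
      by (simp only: meixner_op_props(2)[OF y] lowering_def P.add P.scale P.sum)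
  qed
  also have "\<dots> = scale (- of_nat (card \<nu>)) (rescaled_fs \<epsilon> \<nu>) +
     scale (1 - \<epsilon>) (scale (\<epsilon> ^ card \<nu> / \<epsilon>) (\<Sum>b\<in>corners \<nu>. scale (?w b) (?G (\<nu> - {b}))))"
    by (simp add: rescaled_fs_def complex_sym.scale_right_distrib
        complex_sym.scale_right_diff_distrib mult_ac)
  also have "scale (\<epsilon> ^ card \<nu> / \<epsilon>) (\<Sum>b\<in>corners \<nu>. scale (?w b) (?G (\<nu> - {b}))) =
     (\<Sum>b\<in>corners \<nu>. scale (?w b) (rescaled_fs \<epsilon> (\<nu> - {b})))"
    unfolding complex_sym.scale_sum_right
  proof (rule sum.cong[OF refl])
    fix b assume "b \<in> corners \<nu>"
    then have "card \<nu> = Suc (card (\<nu> - {b}))"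
      using young_finite[OF y] by (intro card.remove) (auto simp: corners_def)
    then show "scale (\<epsilon> ^ card \<nu> / \<epsilon>) (scale (?w b) (?G (\<nu> - {b}))) =
        scale (?w b) (rescaled_fs \<epsilon> (\<nu> - {b}))"
      using \<epsilon> by (simp add: rescaled_fs_def mult_ac)
  qed
  finally show ?thesis .
qed

text \<open>
  By induction on the degree: the operator is known on \<open>rescaled_fs \<epsilon> \<nu>\<close>, which differs from
  \<open>S\<^sub>\<nu>\<close> by monomials of lower weight with coefficients tending to \<open>0\<close>. On those monomials the
  operators converge by induction, so the difference does not contribute to the limit.
\<close>

lemma meixner_eps_tendsto:
  "f \<in> sym_upto n \<Longrightarrow> coeff_tendsto (\<lambda>\<epsilon>. meixner_eps z z' \<epsilon> f) (laguerre_op z z' f)"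
proof (induction n arbitrary: f rule: less_induct)
  case (less n)
  interpret L: Vector_Spaces.linear scale scale "laguerre_op z z'" by (rule laguerre_op_props)
  interpret A: Vector_Spaces.linear scale scale "meixner_eps z z' \<epsilon>" for \<epsilon>
      by (rule meixner_eps_linear)
  let ?V = "{f. coeff_tendsto (\<lambda>\<epsilon>. meixner_eps z z' \<epsilon> f) (laguerre_op z z' f)}"
  have "complex_sym.subspace ?V"
  proof (rule complex_sym.subspaceI)
    show "0 \<in> ?V" by (simp add: L.zero A.zero) (simp add: coeff_tendsto_def)
  qed (auto simp: L.add A.add L.scale A.scale intro: coeff_tendsto_add coeff_tendsto_scale
      tendsto_const)
  moreover have "multi_schur_c (\<lambda>_. 0) \<nu> \<in> ?V" if \<nu>: "\<nu> \<in> young_upto n" for \<nu>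
  proof -
    let ?a = "Poly_Mapping.lookup (multi_schur_c half_points \<nu>)"
    let ?w = "\<lambda>b. (z + of_int (content b)) * (z' + of_int (content b))"
    have y: "\<nu> \<in> young" and k: "card \<nu> \<le> n" using \<nu> by (auto simp: young_upto_def)
    let ?M = "\<lambda>\<epsilon>. \<Sum>m | weight m < card \<nu>. scale (\<epsilon> ^ (card \<nu> - weight m) * ?a m) (meixner_eps z z'
        \<epsilon> (Poly_Mapping.single m 1))"
    let ?F = "\<lambda>\<epsilon>. scale (- of_nat (card \<nu>)) (rescaled_fs \<epsilon> \<nu>) +
      scale (1 - \<epsilon>) (\<Sum>b\<in>corners \<nu>. scale (?w b) (rescaled_fs \<epsilon> (\<nu> - {b})))"
    have eq: "meixner_eps z z' \<epsilon> (multi_schur_c (\<lambda>_. 0) \<nu>) = ?F \<epsilon> - ?M \<epsilon>" if "\<epsilon> \<noteq> 0" for \<epsilon>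
    proof -
      have "?F \<epsilon> = meixner_eps z z' \<epsilon> (rescaled_fs \<epsilon> \<nu>)"
        by (rule meixner_eps_rescaled_fs[OF y that, symmetric])
      also have "\<dots> = meixner_eps z z' \<epsilon> (multi_schur_c (\<lambda>_. 0) \<nu>) + ?M \<epsilon>"
        by (simp only: rescaled_fs_expansion[OF y that] A.add A.sum A.scale)
      finally show ?thesis by simp
    qed
    have lim: "coeff_tendsto (\<lambda>\<epsilon>. ?F \<epsilon> - ?M \<epsilon>) (lowering z z' 1 (\<lambda>_. 0) \<nu> -
        (\<Sum>m | weight m < card \<nu>. scale 0 (laguerre_op z z' (Poly_Mapping.single m 1))))"
      unfolding lowering_def
    proof (intro coeff_tendsto_diff coeff_tendsto_add coeff_tendsto_scale coeff_tendsto_sum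
        rescaled_fs_tendsto y tendsto_const)
      show "((\<lambda>\<epsilon>::complex. 1 - \<epsilon>) \<longlongrightarrow> 1) (at 0)" by (rule tendsto_eq_intros | simp)+
      show "\<nu> - {b} \<in> young" if "b \<in> corners \<nu>" for b using corners_young[OF y that] by simp
      fix m assume "m \<in> {m. weight m < card \<nu>}"
      then have m: "weight m < card \<nu>" by simp
      then show "((\<lambda>\<epsilon>. \<epsilon> ^ (card \<nu> - weight m) * ?a m) \<longlongrightarrow> 0) (at 0)" by (rule tendsto_power_diff_0)
      show "coeff_tendsto (\<lambda>\<epsilon>. meixner_eps z z' \<epsilon> (Poly_Mapping.single m 1)) (laguerre_op z z'
          (Poly_Mapping.single m 1))"
        by (rule less.IH[of "weight m"]) (use m k in \<open>auto simp: sym_upto_def\<close>)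
    qed
    have "coeff_tendsto (\<lambda>\<epsilon>. ?F \<epsilon> - ?M \<epsilon>) (lowering z z' 1 (\<lambda>_. 0) \<nu>)"
      using lim by (simp only: complex_sym.scale_zero_left sum.neutral_const diff_0_right)
    then have "coeff_tendsto (\<lambda>\<epsilon>. meixner_eps z z' \<epsilon> (multi_schur_c (\<lambda>_. 0) \<nu>)) (lowering z z' 1
        (\<lambda>_. 0) \<nu>)"
      by (rule coeff_tendsto_cong[rotated]) (rule eq)
    then show ?thesis by (simp only: laguerre_op_props(2)[OF y] mem_Collect_eq)
  qed
  ultimately have "complex_sym.span (multi_schur_c (\<lambda>_. 0) ` young_upto n) \<subseteq> ?V"
    by (intro complex_sym.span_minimal) auto
  then show ?case using less.prems sym_upto_span_multi_schur_c by blast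
qed

lemma coeff_norm_sym_upto:
  assumes "f \<in> sym_upto n"
  shows "coeff_norm f = (\<Sum>m | weight m \<le> n. norm (Poly_Mapping.lookup f m))"
  unfolding coeff_norm_def using assms card_mono_le_card_young[of n]
  by (intro sum.mono_neutral_left) (auto simp: sym_upto_def in_keys_iff)

lemma op_tendsto_on_sym_uptoI:
  assumes A: "\<And>\<epsilon>. Vector_Spaces.linear scale scale (A \<epsilon>)" "\<And>\<epsilon> f. f \<in> sym_upto n \<Longrightarrow>
      A \<epsilon> f \<in> sym_upto n"
    and B: "Vector_Spaces.linear scale scale B" "\<And>f. f \<in> sym_upto n \<Longrightarrow> B f \<in> sym_upto n"
    and lim: "\<And>f. f \<in> sym_upto n \<Longrightarrow> coeff_tendsto (\<lambda>\<epsilon>. A \<epsilon> f) (B f)"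
  shows "op_tendsto_on (sym_upto n) A B (at 0)"
  unfolding op_tendsto_on_def
proof (intro allI impI)
  fix e :: real assume e: "e > 0"
  let ?M = "{m. weight m \<le> n}"
  have fin: "finite ?M" using card_mono_le_card_young by blast
  let ?d = "\<lambda>\<epsilon> m. A \<epsilon> (Poly_Mapping.single m 1) - B (Poly_Mapping.single m 1)"
  let ?s = "\<lambda>\<epsilon> m. \<Sum>m' \<in> ?M. norm (Poly_Mapping.lookup (?d \<epsilon> m) m')"
  have "((\<lambda>\<epsilon>. ?s \<epsilon> m) \<longlongrightarrow> 0) (at 0)" if "m \<in> ?M" for m
  proof -
    have "coeff_tendsto (\<lambda>\<epsilon>. A \<epsilon> (Poly_Mapping.single m 1)) (B (Poly_Mapping.single m 1))"
      by (rule lim) (use that in \<open>simp add: sym_upto_def\<close>)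
    then have "((\<lambda>\<epsilon>. ?s \<epsilon> m) \<longlongrightarrow> (\<Sum>m'\<in>?M. norm (Poly_Mapping.lookup (B (Poly_Mapping.single m 1)) m'
        - Poly_Mapping.lookup (B (Poly_Mapping.single m 1)) m'))) (at 0)"
      unfolding lookup_minus coeff_tendsto_def
          by (intro tendsto_sum tendsto_norm tendsto_diff tendsto_const) blast
    then show ?thesis by simp
  qed
  then have "\<forall>m\<in>?M. \<forall>\<^sub>F \<epsilon> in at 0. ?s \<epsilon> m < e"
    using order_tendstoD(2)[OF _ e] by blast
  then have "\<forall>\<^sub>F \<epsilon> in at 0. \<forall>m\<in>?M. ?s \<epsilon> m < e"
    by (rule eventually_ball_finite[OF fin])
  then show "\<forall>\<^sub>F \<epsilon> in at 0. \<forall>f\<in>sym_upto n. coeff_norm (A \<epsilon> f - B f) \<le> e * coeff_norm f"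
  proof eventually_elim
    case (elim \<epsilon>)
    interpret A: Vector_Spaces.linear scale scale "A \<epsilon>" by (rule A)
    interpret B: Vector_Spaces.linear scale scale B by (rule B)
    show ?case
    proof
      fix f :: "complex sym" assume f: "f \<in> sym_upto n"
      let ?a = "Poly_Mapping.lookup f"
      have "f = (\<Sum>m\<in>Poly_Mapping.keys f. scale (?a m) (Poly_Mapping.single m 1))"
        by (rule complex_mpoly_sum_monomials)
      also have "\<dots> = (\<Sum>m\<in>?M. scale (?a m) (Poly_Mapping.single m 1))"
      proof (rule sum.mono_neutral_left[OF fin])
        show "Poly_Mapping.keys f \<subseteq> ?M" using f by (auto simp: sym_upto_def)
        show "\<forall>m\<in>?M - Poly_Mapping.keys f. scale (?a m) (Poly_Mapping.single m 1) = 0"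
          by (simp add: in_keys_iff)
      qed
      finally have f_eq: "f = (\<Sum>m\<in>?M. scale (?a m) (Poly_Mapping.single m 1))" .
      have "A \<epsilon> f - B f = (\<Sum>m\<in>?M. scale (?a m) (?d \<epsilon> m))"
        by (subst (1 2) f_eq) (simp add: A.sum B.sum A.scale B.scale sum_subtractf
            complex_sym.scale_right_diff_distrib)
      then have diff: "Poly_Mapping.lookup (A \<epsilon> f - B f) m' =
          (\<Sum>m\<in>?M. ?a m * Poly_Mapping.lookup (?d \<epsilon> m) m')" for m'
        by (simp add: lookup_sum)
      have "A \<epsilon> f - B f \<in> sym_upto n"
        by (intro complex_sym.subspace_diff[OF subspace_sym_upto] A(2) B(2) f)
      then have "coeff_norm (A \<epsilon> f - B f) = (\<Sum>m'\<in>?M. norm (\<Sum>m\<in>?M. ?a m * Poly_Mapping.lookup (?d \<epsilon>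
          m) m'))"
        by (simp only: coeff_norm_sym_upto diff)
      also have "\<dots> \<le> (\<Sum>m'\<in>?M. \<Sum>m\<in>?M. norm (?a m) * norm (Poly_Mapping.lookup (?d \<epsilon> m) m'))"
        by (intro sum_mono order_trans[OF norm_sum]) (simp add: norm_mult)
      also have "\<dots> = (\<Sum>m\<in>?M. norm (?a m) * ?s \<epsilon> m)"
        by (subst sum.swap) (simp only: sum_distrib_left)
      also have "\<dots> \<le> (\<Sum>m\<in>?M. norm (?a m) * e)"
        by (intro sum_mono mult_left_mono) (use elim in \<open>auto intro: less_imp_le\<close>)
      also have "\<dots> = e * coeff_norm f"
        by (simp only: coeff_norm_sym_upto[OF f] sum_distrib_left mult.commute)
      finally show "coeff_norm (A \<epsilon> f - B f) \<le> e * coeff_norm f" .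
    qed
  qed
qed

theorem corollary4p31:
  fixes z z' :: complex
  shows "\<forall>n. laguerre_op z z' ` sym_upto n \<subseteq> sym_upto n \<and>
             (\<forall>\<epsilon>. \<epsilon> \<noteq> 0 \<longrightarrow> meixner_eps z z' \<epsilon> ` sym_upto n \<subseteq> sym_upto n) \<and>
             op_tendsto_on (sym_upto n) (meixner_eps z z') (laguerre_op z z') (at 0)"
proof (intro allI conjI impI)
  fix n
  show "laguerre_op z z' ` sym_upto n \<subseteq> sym_upto n"
    by (auto intro: laguerre_in_sym_upto)
  show "meixner_eps z z' \<epsilon> ` sym_upto n \<subseteq> sym_upto n" for \<epsilon>
    by (auto intro: meixner_eps_in_sym_upto)
  show "op_tendsto_on (sym_upto n) (meixner_eps z z') (laguerre_op z z') (at 0)"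
    by (rule op_tendsto_on_sym_uptoI)
       (fact meixner_eps_linear meixner_eps_in_sym_upto laguerre_op_props(1) laguerre_in_sym_upto
           meixner_eps_tendsto)+
qed

end
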